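(* There is an algorithm which, given a number $\epsilon$ with $0<\epsilon<1$, computes a real number within $\epsilon$ of $\overline{\alpha}$, and which runs in time $O\left(1.6538^{(-2\log_2 \epsilon)^{1/\epsilon}}\right)$.
   Context: A three-term geometric progression is a triple $(a, ak, ak^2)$ of positive integers with $k\in\mathbb{Q}$, $k>1$. $\overline{\alpha}=\sup\{\bar d(A): A\subset\mathbb{N}\text{ contains no three-term geometric progression}\}$, where $\bar d(A)=\limsup_{N\to\infty}|A\cap\{1,\dots,N\}|/N$ is the upper density. *)

theory Defs
  imports "HOL-Analysis.Analysis" "HOL-Library.Landau_Symbols"
begin

definition geometric_progression3 :: "nat \<Rightarrow> nat \<Rightarrow> nat \<Rightarrow> bool" where
  "geometric_progression3 x y z \<longleftrightarrow>
     0 < x \<and> (\<exists>k::rat. 1 < k \<and> of_nat y = of_nat x * k \<and> of_nat z = of_nat x * k ^ 2)"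

definition gp3_free :: "nat set \<Rightarrow> bool" where
  "gp3_free A \<longleftrightarrow> \<not> (\<exists>x\<in>A. \<exists>y\<in>A. \<exists>z\<in>A. geometric_progression3 x y z)"

text \<open>The upper limit is taken in the extended reals, where it always exists; the quotients
  lie in \<open>[0, 1]\<close>, so nothing is lost by mapping the result back to the reals.
  (The value at \<open>N = 0\<close> is \<open>0 / 0 = 0\<close> and irrelevant.)\<close>

definition upper_density :: "nat set \<Rightarrow> real" where
  "upper_density A =
     real_of_ereal (limsup (\<lambda>N. ereal (real (card (A \<inter> {1..N})) / real N)))"

definition alpha_bar :: real where
  "alpha_bar = (SUP A \<in> {A. A \<subseteq> {1..} \<and> gp3_free A}. upper_density A)"

text \<open>Algorithms are programs for a random access machine with natural-number registers and
  a natural-number memory, and unit-cost instructions.  As usual for unit cost, the arithmetic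
  is limited to addition and truncated subtraction, so that numbers grow by at most one bit per
  step (once they exceed the constants of the program) and the model is polynomially
  equivalent to Turing machines.

  A real input in \<open>[0, 1]\<close> is presented as an infinite read-only array of binary digits, of
  which a terminating run inspects only finitely many.\<close>

datatype ram_prog =
    Const nat nat                     \<comment> \<open>\<open>r\<^sub>x := n\<close>\<close>
  | Add nat nat nat                   \<comment> \<open>\<open>r\<^sub>x := r\<^sub>y + r\<^sub>z\<close>\<close>
  | Sub nat nat nat                   \<comment> \<open>\<open>r\<^sub>x := r\<^sub>y - r\<^sub>z\<close>, truncated at 0\<close>
  | Load nat nat                      \<comment> \<open>\<open>r\<^sub>x := mem[r\<^sub>y]\<close>\<close>
  | Store nat nat                     \<comment> \<open>\<open>mem[r\<^sub>x] := r\<^sub>y\<close>\<close>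
  | Input nat nat                     \<comment> \<open>\<open>r\<^sub>x := input digit number r\<^sub>y\<close>\<close>
  | Seq ram_prog ram_prog
  | IfNZ nat ram_prog ram_prog        \<comment> \<open>branch on \<open>r\<^sub>x \<noteq> 0\<close>\<close>
  | WhileNZ nat ram_prog              \<comment> \<open>loop while \<open>r\<^sub>x \<noteq> 0\<close>\<close>

record ram_state =
  regs :: "nat \<Rightarrow> nat"
  mem  :: "nat \<Rightarrow> nat"

text \<open>\<open>ram_exec d c s t s'\<close>: on input digits \<open>d\<close>, program \<open>c\<close> started in state \<open>s\<close> halts in
  state \<open>s'\<close> after exactly \<open>t\<close> elementary steps (each test of a branch or loop counts as one).\<close>

inductive ram_exec ::
  "(nat \<Rightarrow> bool) \<Rightarrow> ram_prog \<Rightarrow> ram_state \<Rightarrow> nat \<Rightarrow> ram_state \<Rightarrow> bool"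
  for d :: "nat \<Rightarrow> bool"
where
  Const: "ram_exec d (Const x n) s 1 (s\<lparr>regs := (regs s)(x := n)\<rparr>)"
| Add: "ram_exec d (Add x y z) s 1 (s\<lparr>regs := (regs s)(x := regs s y + regs s z)\<rparr>)"
| Sub: "ram_exec d (Sub x y z) s 1 (s\<lparr>regs := (regs s)(x := regs s y - regs s z)\<rparr>)"
| Load: "ram_exec d (Load x y) s 1 (s\<lparr>regs := (regs s)(x := mem s (regs s y))\<rparr>)"
| Store: "ram_exec d (Store x y) s 1 (s\<lparr>mem := (mem s)(regs s x := regs s y)\<rparr>)"
| Input: "ram_exec d (Input x y) s 1 (s\<lparr>regs := (regs s)(x := of_bool (d (regs s y)))\<rparr>)"
| Seq: "ram_exec d c1 s t1 s1 \<Longrightarrow> ram_exec d c2 s1 t2 s2 \<Longrightarrow>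
    ram_exec d (Seq c1 c2) s (t1 + t2) s2"
| IfTrue: "regs s x \<noteq> 0 \<Longrightarrow> ram_exec d c1 s t s1 \<Longrightarrow> ram_exec d (IfNZ x c1 c2) s (Suc t) s1"
| IfFalse: "regs s x = 0 \<Longrightarrow> ram_exec d c2 s t s1 \<Longrightarrow> ram_exec d (IfNZ x c1 c2) s (Suc t) s1"
| WhileFalse: "regs s x = 0 \<Longrightarrow> ram_exec d (WhileNZ x c) s 1 s"
| WhileTrue: "regs s x \<noteq> 0 \<Longrightarrow> ram_exec d c s t1 s1 \<Longrightarrow> ram_exec d (WhileNZ x c) s1 t2 s2 \<Longrightarrow>
    ram_exec d (WhileNZ x c) s (Suc (t1 + t2)) s2"

lemma ram_exec_deterministic:
  "ram_exec d c s t s1 \<Longrightarrow> ram_exec d c s t' s2 \<Longrightarrow> t' = t \<and> s2 = s1"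
proof (induction arbitrary: t' s2 rule: ram_exec.induct)
  case (Seq c1 s u1 s1 c2 u2 s3)
  from Seq.prems obtain v1 v2 s1' where *:
    "t' = v1 + v2" "ram_exec d c1 s v1 s1'" "ram_exec d c2 s1' v2 s2"
    by (cases rule: ram_exec.cases) simp_all
  from Seq.IH(1)[OF *(2)] Seq.IH(2)[of v2 s2] * show ?case by simp
next
  case (IfTrue s x c1 t s1 c2)
  from IfTrue.prems IfTrue.hyps(1) obtain v where *: "t' = Suc v" "ram_exec d c1 s v s2"
    by (cases rule: ram_exec.cases) simp_all
  from IfTrue.IH[OF *(2)] * show ?case by simp
next
  case (IfFalse s x c2 t s1 c1)
  from IfFalse.prems IfFalse.hyps(1) obtain v where *: "t' = Suc v" "ram_exec d c2 s v s2"
    by (cases rule: ram_exec.cases) simp_all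
  from IfFalse.IH[OF *(2)] * show ?case by simp
next
  case (WhileFalse s x c)
  from WhileFalse.prems WhileFalse.hyps show ?case
    by (cases rule: ram_exec.cases) simp_all
next
  case (WhileTrue s x c u1 s1 u2 s3)
  from WhileTrue.prems WhileTrue.hyps(1) obtain v1 v2 s1' where *:
    "t' = Suc (v1 + v2)" "ram_exec d c s v1 s1'" "ram_exec d (WhileNZ x c) s1' v2 s2"
    by (cases rule: ram_exec.cases) simp_all
  from WhileTrue.IH(1)[OF *(2)] WhileTrue.IH(2)[of v2 s2] * show ?case by simp
qed (erule ram_exec.cases; simp)+

definition ram_init :: ram_state where
  "ram_init = \<lparr>regs = (\<lambda>_. 0), mem = (\<lambda>_. 0)\<rparr>"

text \<open>The output is the quotient of the first two registers; a zero denominator does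
  not count as an output.\<close>

definition ram_computes ::
  "ram_prog \<Rightarrow> (nat \<Rightarrow> bool) \<Rightarrow> nat \<Rightarrow> real \<Rightarrow> bool" where
  "ram_computes c d t v \<longleftrightarrow> (\<exists>s. ram_exec d c ram_init t s \<and> regs s 1 \<noteq> 0 \<and>
     v = real (regs s 0) / real (regs s 1))"

text \<open>A dyadic number has two binary expansions; both count as presentations of it.\<close>

definition binary_expansion :: "(nat \<Rightarrow> bool) \<Rightarrow> real \<Rightarrow> bool" where
  "binary_expansion d x \<longleftrightarrow> (\<lambda>i. of_bool (d i) / 2 ^ Suc i) sums x"

end

theory Submission
  imports Defs "HOL-Computational_Algebra.Squarefree" "HOL-Library.Nat_Bijection"
begin

text \<open>Let \<open>f N\<close> be the largest size of a progression-free subset of \<open>{1..N}\<close>. The program finds the first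
  digit \<open>1\<close> of \<open>\<epsilon>\<close>, say digit \<open>i\<close>, and outputs \<open>f N / N\<close> for \<open>N = 2 ^ (152 * 2 ^ i)\<close>, computing
  \<open>f N\<close> by exhaustive search in \<open>2 ^ O(N)\<close> steps. As \<open>2 ^ i \<le> 1 / \<epsilon>\<close>, this is doubly exponential in
  \<open>1 / \<epsilon>\<close>, whereas the base \<open>- 2 * log 2 \<epsilon>\<close> in the claimed bound tends to infinity; so exhaustive
  search is fast enough and no clever hypergraph algorithm is needed.

  What makes such a small \<open>N\<close> sufficient is that \<open>f\<close> is nearly the counting function of a periodic set.
  Let \<open>Q\<close> be the product over the primes \<open>p \<le> K\<close> of the least power of \<open>p\<close> exceeding \<open>K\<^sup>2\<close>; Chebyshev's
  bound makes \<open>Q\<close> exponential in \<open>K\<close>. Up to at most \<open>N / K\<close> exceptions, every \<open>n \<le> N\<close> is \<open>m * s\<close> with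
  \<open>s = gcd n Q\<close> and \<open>m\<close> coprime to \<open>Q\<close>. A progression-free set meets the fibre over \<open>m\<close> in a progression-free
  set of divisors \<open>s \<le> N / m\<close> of \<open>Q\<close>; conversely, optimal fibres over the squarefree \<open>m\<close>
  (all but \<open>N / K\<close> numbers) form a progression-free set, because a progression with squarefree cofactors has
  constant cofactor. The sum of the fibre optima counts the \<open>n \<le> N\<close> for which the fibre
  optimum jumps at \<open>gcd n Q\<close>, a condition periodic modulo \<open>Q\<close>. Hence \<open>f N / N\<close> is within
  \<open>2 / K + Q / N\<close> of its limit, which is \<open>alpha_bar\<close>: glue optimal sets on intervals
  \<open>(N\<^sub>j / R, N\<^sub>j]\<close> with \<open>N\<^sub>j = R ^ (4 ^ j)\<close>.\<close>

subsection \<open>Progression-free sets and cofactors\<close>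

text \<open>The ratio is \<open>k = y / x\<close>; positivity of \<open>x\<close> comes for free,
  since \<open>x = 0\<close> would force \<open>y = 0\<close>. The right-hand side is the integer
  condition that the search program tests.\<close>

lemma geometric_progression3_iff:
  "geometric_progression3 x y z \<longleftrightarrow> x < y \<and> y * y = x * z"
proof
  assume "geometric_progression3 x y z"
  then obtain k :: rat where x: "0 < x" and k: "1 < k" and y: "of_nat y = of_nat x * k"
    and z: "of_nat z = of_nat x * k ^ 2"
    unfolding geometric_progression3_def by blast
  have "(of_nat x :: rat) < of_nat y" using x k y by simp
  moreover have "(of_nat (y * y) :: rat) = of_nat (x * z)"
    using y z by (simp add: power2_eq_square)
  ultimately show "x < y \<and> y * y = x * z"
    by (simp only: of_nat_less_iff of_nat_eq_iff)
next
  assume *: "x < y \<and> y * y = x * z"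
  then have x: "0 < x" by (cases x) auto
  define k :: rat where "k = of_nat y / of_nat x"
  have "(of_nat y * of_nat y :: rat) = of_nat x * of_nat z"
    using * by (metis of_nat_mult)
  then show "geometric_progression3 x y z"
    unfolding geometric_progression3_def using * x
    by (intro conjI exI[of _ k]) (auto simp: k_def field_simps power2_eq_square)
qed

lemma gp3_free_iff: "gp3_free A \<longleftrightarrow> \<not> (\<exists>x\<in>A. \<exists>y\<in>A. \<exists>z\<in>A. x < y \<and> y * y = x * z)"
  unfolding gp3_free_def geometric_progression3_iff ..

lemma gp3_free_empty [simp]: "gp3_free {}"
  by (simp add: gp3_free_def)

lemma gp3_free_subset: "gp3_free B \<Longrightarrow> A \<subseteq> B \<Longrightarrow> gp3_free A"
  unfolding gp3_free_def by blast

section \<open>Extremal sizes as counting functions\<close>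

definition gp3_max :: "nat set \<Rightarrow> nat" where
  "gp3_max X = Max (card ` {A. A \<subseteq> X \<and> gp3_free A})"

lemma card_le_gp3_max:
  assumes "finite X" "A \<subseteq> X" "gp3_free A"
  shows "card A \<le> gp3_max X"
  unfolding gp3_max_def using assms by (intro Max_ge) auto

lemma gp3_max_attained:
  assumes "finite X"
  obtains A where "A \<subseteq> X" "gp3_free A" "card A = gp3_max X"
proof -
  have "gp3_max X \<in> card ` {A. A \<subseteq> X \<and> gp3_free A}"
    unfolding gp3_max_def using assms by (intro Max_in) auto
  then show thesis using that by auto
qed

lemma gp3_max_le_card:
  assumes "finite X" shows "gp3_max X \<le> card X"
  using gp3_max_attained[OF assms] by (metis assms card_mono)

lemma gp3_max_mono:
  assumes "finite Y" "X \<subseteq> Y" shows "gp3_max X \<le> gp3_max Y"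
proof -
  have "finite X" using assms finite_subset by blast
  then obtain A where "A \<subseteq> X" "gp3_free A" "card A = gp3_max X"
    by (rule gp3_max_attained)
  then show ?thesis using card_le_gp3_max[OF assms(1), of A] assms(2) by auto
qed

lemma gp3_max_insert_le:
  assumes "finite X" shows "gp3_max (insert x X) \<le> Suc (gp3_max X)"
proof -
  obtain A where A: "A \<subseteq> insert x X" "gp3_free A" "card A = gp3_max (insert x X)"
    using gp3_max_attained[of "insert x X"] assms by auto
  have "card (A - {x}) \<le> gp3_max X"
    using A by (intro card_le_gp3_max assms gp3_free_subset[OF A(2)]) auto
  moreover have "card A \<le> Suc (card (A - {x}))"
    by (metis card_Suc_Diff1 Diff_empty Diff_insert0 A(1) assms finite_insert finite_subset le_SucI order_refl)
  ultimately show ?thesis using A by simp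
qed

definition jumps :: "nat set \<Rightarrow> nat set" where
  "jumps S = {s \<in> S. gp3_max {t \<in> S. t \<le> s} \<noteq> gp3_max {t \<in> S. t < s}}"

text \<open>One more element raises the optimum by 0 or 1 (\<open>gp3_max_mono\<close>,
  \<open>gp3_max_insert_le\<close>), so the optimum counts the elements at which it rises. This lets
  a sum of fibre optima become the cardinality of one set of integers.\<close>

lemma gp3_max_eq_card_jumps:
  assumes "0 \<notin> S"
  shows "gp3_max {s \<in> S. s \<le> x} = card {s \<in> jumps S. s \<le> x}"
proof (induction x)
  case 0
  have "{s \<in> S. s \<le> 0} = {}" "{s \<in> jumps S. s \<le> 0} = {}"
    using assms by (auto simp: jumps_def intro: Nat.gr0I)
  then show ?case using gp3_max_le_card[of "{}"] by (simp only: card.empty) simp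
next
  case (Suc x)
  have less: "{t \<in> S. t < Suc x} = {t \<in> S. t \<le> x}" by auto
  show ?case
  proof (cases "Suc x \<in> S")
    case True
    then have ins: "{t \<in> S. t \<le> Suc x} = insert (Suc x) {t \<in> S. t \<le> x}"
      by (auto simp: le_Suc_eq)
    have mono: "gp3_max {t \<in> S. t \<le> x} \<le> gp3_max {t \<in> S. t \<le> Suc x}"
      by (rule gp3_max_mono) auto
    have step: "gp3_max {t \<in> S. t \<le> Suc x} \<le> Suc (gp3_max {t \<in> S. t \<le> x})"
      unfolding ins by (rule gp3_max_insert_le) auto
    show ?thesis
    proof (cases "Suc x \<in> jumps S")
      case j: True
      then have "{s \<in> jumps S. s \<le> Suc x} = insert (Suc x) {s \<in> jumps S. s \<le> x}"
        by (auto simp: le_Suc_eq)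
      then have "card {s \<in> jumps S. s \<le> Suc x} = Suc (card {s \<in> jumps S. s \<le> x})"
        by simp
      then show ?thesis using j mono step Suc less by (simp add: jumps_def)
    next
      case j: False
      then have "{s \<in> jumps S. s \<le> Suc x} = {s \<in> jumps S. s \<le> x}"
        by (metis le_Suc_eq)
      then show ?thesis using j True Suc less by (simp add: jumps_def)
    qed
  next
    case False
    then have "{s \<in> S. s \<le> Suc x} = {s \<in> S. s \<le> x}"
      "{s \<in> jumps S. s \<le> Suc x} = {s \<in> jumps S. s \<le> x}"
      by (auto simp: le_Suc_eq jumps_def)
    then show ?thesis using Suc by simp
  qed
qed

text \<open>These are the divisors in which each prime of \<open>Q\<close> has a strictly smaller
  exponent than in \<open>Q\<close>. If \<open>gcd n Q\<close> is of this kind, it contains the full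
  power of every such prime in \<open>n\<close>.\<close>

definition core_divisors :: "nat \<Rightarrow> nat set" where
  "core_divisors Q = {s. s dvd Q \<and> (\<forall>p. prime p \<and> p dvd Q \<longrightarrow> p * s dvd Q)}"

lemma core_divisors_pos: "Q > 0 \<Longrightarrow> s \<in> core_divisors Q \<Longrightarrow> s > 0"
  unfolding core_divisors_def by (auto intro: Nat.gr0I)

lemma finite_core_divisors: "Q > 0 \<Longrightarrow> finite (core_divisors Q)"
  by (rule finite_subset[of _ "{s. s dvd Q}"]) (auto simp: core_divisors_def)

lemma gcd_core_divisor:
  assumes "s \<in> core_divisors Q" "coprime m Q"
  shows "gcd (m * s) Q = s"
  using assms by (simp add: core_divisors_def gcd_mult_left_left_cancel gcd_nat.absorb1
      coprime_commute)

text \<open>A common prime \<open>p\<close> of the cofactor and \<open>Q\<close> would make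
  \<open>p * gcd n Q\<close> a common divisor of \<open>n\<close> and \<open>Q\<close>.\<close>

lemma coprime_cofactor:
  assumes "n > 0" "Q > 0" "gcd n Q \<in> core_divisors Q"
  shows "coprime (n div gcd n Q) Q"
proof (rule ccontr)
  let ?s = "gcd n Q"
  assume "\<not> coprime (n div ?s) Q"
  then obtain p where p: "prime p" "p dvd n div ?s" "p dvd Q"
    by (metis coprime_iff_gcd_eq_1 gcd_greatest_iff prime_factor_nat dvd_refl)
  have "p * ?s dvd (n div ?s) * ?s" using p(2) by (intro mult_dvd_mono) auto
  moreover have "p * ?s dvd Q" using assms(3) p by (simp add: core_divisors_def)
  ultimately have "p * ?s dvd 1 * ?s" by simp
  moreover have "?s \<noteq> 0" using assms(1) by simp
  ultimately have "p dvd 1" by (metis dvd_times_right_cancel_iff)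
  with p(1) show False by (simp add: prime_nat_iff)
qed

text \<open>Multiplication maps the pairs \<open>(m, s)\<close> bijectively onto \<open>X\<close>,
  because \<open>s\<close> is recovered as \<open>gcd (m * s) Q\<close>.\<close>

lemma card_by_cofactor:
  assumes Q: "Q > 0" and X: "X \<subseteq> {1..N}" and core: "\<And>n. n \<in> X \<Longrightarrow> gcd n Q \<in> core_divisors Q"
  shows "card X = (\<Sum>m | m \<in> {1..N} \<and> coprime m Q. card {s \<in> core_divisors Q. m * s \<in> X})"
proof -
  let ?M = "{m. m \<in> {1..N} \<and> coprime m Q}"
  let ?F = "\<lambda>m. {s \<in> core_divisors Q. m * s \<in> X}"
  have img: "X = (\<lambda>(m, s). m * s) ` Sigma ?M ?F"
  proof (intro equalityI subsetI)
    fix n assume n: "n \<in> X"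
    let ?s = "gcd n Q"
    have eq: "n div ?s * ?s = n" by simp
    have "n \<ge> 1" "n \<le> N" using n X by auto
    then have "n div ?s \<in> ?M"
      using coprime_cofactor[of n Q] core[OF n] Q
      by (auto simp: div_greater_zero_iff Suc_le_eq intro: le_trans[OF div_le_dividend]
          intro!: gcd_le1_nat)
    then show "n \<in> (\<lambda>(m, s). m * s) ` Sigma ?M ?F"
      using n core[OF n] eq by (intro image_eqI[of _ _ "(n div ?s, ?s)"]) auto
  qed auto
  have inj: "inj_on (\<lambda>(m, s). m * s) (Sigma ?M ?F)"
  proof (rule inj_onI, clarify)
    fix m s m' s' :: nat
    assume *: "coprime m Q" "coprime m' Q" "s \<in> core_divisors Q" "s' \<in> core_divisors Q"
      "m * s = m' * s'"
    then have "s = s'" using gcd_core_divisor by metis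
    then show "m = m' \<and> s = s'" using * core_divisors_pos[OF Q] by auto
  qed
  have "card X = card (Sigma ?M ?F)"
    by (subst img) (rule card_image[OF inj])
  also have "\<dots> = (\<Sum>m\<in>?M. card (?F m))"
    using finite_core_divisors[OF Q] by (intro card_SigmaI) auto
  finally show ?thesis .
qed

text \<open>Membership depends on \<open>gcd n Q\<close> alone, which makes this set periodic modulo
  \<open>Q\<close>.\<close>

definition jump_class :: "nat \<Rightarrow> nat set" where
  "jump_class Q = {n. gcd n Q \<in> jumps (core_divisors Q)}"

lemma zero_notin_core: "Q > 0 \<Longrightarrow> 0 \<notin> core_divisors Q"
  using core_divisors_pos by blast

text \<open>The fibre over \<open>m\<close> consists of the jumps up to \<open>N div m\<close>, and
  \<open>gp3_max_eq_card_jumps\<close> turns their number into an optimum.\<close>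

lemma card_jump_class:
  assumes Q: "Q > 0"
  shows "card (jump_class Q \<inter> {1..N}) =
    (\<Sum>m | m \<in> {1..N} \<and> coprime m Q. gp3_max {s \<in> core_divisors Q. s \<le> N div m})"
proof -
  have sub: "jumps (core_divisors Q) \<subseteq> core_divisors Q" by (auto simp: jumps_def)
  have "card (jump_class Q \<inter> {1..N}) = (\<Sum>m | m \<in> {1..N} \<and> coprime m Q.
    card {s \<in> core_divisors Q. m * s \<in> jump_class Q \<inter> {1..N}})"
    using sub by (intro card_by_cofactor Q) (auto simp: jump_class_def)
  also have "\<dots> = (\<Sum>m | m \<in> {1..N} \<and> coprime m Q. gp3_max {s \<in> core_divisors Q. s \<le> N div m})"
  proof (rule sum.cong[OF refl])
    fix m assume "m \<in> {m. m \<in> {1..N} \<and> coprime m Q}"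
    then have m: "m \<ge> 1" "coprime m Q" by auto
    have "{s \<in> core_divisors Q. m * s \<in> jump_class Q \<inter> {1..N}} =
      {s \<in> jumps (core_divisors Q). s \<le> N div m}"
    proof -
      have "m * s \<in> {1..N} \<longleftrightarrow> s \<le> N div m" if "s \<in> core_divisors Q" for s
        using m core_divisors_pos[OF Q that] by (auto simp: less_eq_div_iff_mult_less_eq mult.commute)
      then show ?thesis
        using m sub gcd_core_divisor[OF _ m(2)] by (auto simp: jump_class_def)
    qed
    then show "card {s \<in> core_divisors Q. m * s \<in> jump_class Q \<inter> {1..N}} =
      gp3_max {s \<in> core_divisors Q. s \<le> N div m}"
      using gp3_max_eq_card_jumps[OF zero_notin_core[OF Q]] by simp
  qed
  finally show ?thesis .
qed

lemma gp3_free_fiber: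
  assumes "gp3_free A" "m > 0" shows "gp3_free {s \<in> S. m * s \<in> A}"
  unfolding gp3_free_iff
proof clarify
  fix x y z assume "m * x \<in> A" "m * y \<in> A" "m * z \<in> A" "x < y" "y * y = x * z"
  moreover from this have "m * x < m * y" "(m * y) * (m * y) = (m * x) * (m * z)"
    using assms by (auto simp: algebra_simps)
  ultimately show False using assms(1) unfolding gp3_free_iff by blast
qed

text \<open>An optimal set is cut into fibres; each is progression-free by
  \<open>gp3_free_fiber\<close>, so no larger than the fibre optimum. Elements whose gcd is not a
  core divisor are counted trivially.\<close>

lemma gp3_max_le_jump_class:
  assumes Q: "Q > 0"
  shows "gp3_max {1..N} \<le> card (jump_class Q \<inter> {1..N}) +
    card {n \<in> {1..N}. gcd n Q \<notin> core_divisors Q}"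
proof -
  obtain A where A: "A \<subseteq> {1..N}" "gp3_free A" "card A = gp3_max {1..N}"
    using gp3_max_attained[of "{1..N}"] by auto
  let ?W = "{n. gcd n Q \<in> core_divisors Q}"
  have "card (A \<inter> ?W) =
    (\<Sum>m | m \<in> {1..N} \<and> coprime m Q. card {s \<in> core_divisors Q. m * s \<in> A \<inter> ?W})"
    using A by (intro card_by_cofactor Q) auto
  also have "\<dots> \<le> card (jump_class Q \<inter> {1..N})"
    unfolding card_jump_class[OF Q]
  proof (rule sum_mono)
    fix m assume "m \<in> {m. m \<in> {1..N} \<and> coprime m Q}"
    then have m: "m \<ge> 1" by auto
    have "s \<le> N div m" if "m * s \<in> A" for s
      using m that A(1) by (auto simp: less_eq_div_iff_mult_less_eq mult.commute)
    then show "card {s \<in> core_divisors Q. m * s \<in> A \<inter> ?W} \<le>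
        gp3_max {s \<in> core_divisors Q. s \<le> N div m}"
      using m by (intro card_le_gp3_max gp3_free_fiber gp3_free_subset[OF A(2)]) auto
  qed
  finally have "card (A \<inter> ?W) \<le> card (jump_class Q \<inter> {1..N})" .
  moreover have "card (A - ?W) \<le> card {n \<in> {1..N}. gcd n Q \<notin> core_divisors Q}"
    using A(1) by (intro card_mono) auto
  moreover have "card A = card (A \<inter> ?W) + card (A - ?W)"
    using A(1) by (metis card_Int_Diff finite_atLeastAtMost finite_subset)
  ultimately show ?thesis using A(3) by linarith
qed

section \<open>Squarefree cofactors and the reverse inequality\<close>

lemma squarefree_dvd_square:
  assumes "squarefree (m :: nat)" "m dvd n * n" shows "m dvd n"
proof (cases "n = 0")
  case False
  have "m \<noteq> 0" using assms(1) by (metis not_squarefree_0)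
  then show ?thesis
  proof (rule multiplicity_le_imp_dvd)
    fix p :: nat assume p: "prime p"
    show "multiplicity p m \<le> multiplicity p n"
    proof (cases "p dvd m")
      case True
      then have "p dvd n" using assms(2) p by (metis dvd_trans prime_dvd_multD)
      then have "1 \<le> multiplicity p n" using False p by (simp add: Suc_le_eq prime_multiplicity_gt_zero_iff)
      moreover have "multiplicity p m \<le> 1"
        using assms(1) p True by (simp add: squarefree_factorial_semiring'' \<open>m \<noteq> 0\<close>)
      ultimately show ?thesis by simp
    qed (simp add: not_dvd_imp_multiplicity_0)
  qed
qed auto

text \<open>Being squarefree, \<open>m1\<close> and \<open>m3\<close> divide \<open>m2\<close>
  because they divide its square; two factors of size at most \<open>m2\<close> with product
  \<open>m2 * m2\<close> both equal \<open>m2\<close>.\<close>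

lemma squarefree_cofactors_eq:
  assumes "squarefree (m1 :: nat)" "squarefree m3" "m1 * m3 = m2 * m2"
  shows "m1 = m2 \<and> m3 = m2"
proof -
  have m: "m1 > 0" "m3 > 0" using assms by (auto intro: Nat.gr0I)
  then have "m2 > 0" using assms(3) by (auto intro: Nat.gr0I)
  moreover have "m1 dvd m2" "m3 dvd m2"
    using assms by (metis squarefree_dvd_square dvd_triv_left dvd_triv_right)+
  ultimately have le: "m1 \<le> m2" "m3 \<le> m2" by (auto dest: dvd_imp_le)
  have "m1 = m2"
  proof (rule ccontr)
    assume "m1 \<noteq> m2"
    then have "m1 * m3 < m2 * m2" using le m by (intro mult_less_le_imp_less) auto
    then show False using assms(3) by simp
  qed
  then show ?thesis using assms(3) \<open>m2 > 0\<close> by simp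
qed

text \<open>Putting an optimal set into every fibre gives a set \<open>X\<close> as large as the
  jump class. Deleting \<open>E\<close> leaves only squarefree cofactors; a progression in the rest
  would have a single cofactor, so its gcds would form a progression inside one optimal
  fibre.\<close>

lemma jump_class_le_gp3_max:
  assumes Q: "Q > 0"
  shows "card (jump_class Q \<inter> {1..N}) \<le> gp3_max {1..N} +
    card {n \<in> {1..N}. \<exists>l. prime l \<and> \<not> l dvd Q \<and> l * l dvd n}"
proof -
  define S where "S x = {s \<in> core_divisors Q. s \<le> x}" for x
  have fin: "finite (S x)" for x by (simp add: S_def)
  have "\<forall>x. \<exists>B. B \<subseteq> S x \<and> gp3_free B \<and> card B = gp3_max (S x)"
    using gp3_max_attained[OF fin] by metis
  then obtain B where B: "\<And>x. B x \<subseteq> S x" "\<And>x. gp3_free (B x)" "\<And>x. card (B x) = gp3_max (S x)"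
    by metis
  define cof where "cof n = n div gcd n Q" for n
  \<comment> \<open>The optimal set depends only on the bound \<open>N div cof n\<close>, so numbers
    with equal cofactors draw their gcds from the same progression-free set.\<close>
  define X where "X = {n \<in> {1..N}. gcd n Q \<in> B (N div cof n)}"
  define E where "E = {n \<in> {1..N}. \<exists>l. prime l \<and> \<not> l dvd Q \<and> l * l dvd n}"
  have core: "gcd n Q \<in> core_divisors Q" if "n \<in> X" for n
    using that B(1) by (auto simp: X_def S_def)
  have "card X = (\<Sum>m | m \<in> {1..N} \<and> coprime m Q. card {s \<in> core_divisors Q. m * s \<in> X})"
    using core by (intro card_by_cofactor Q) (auto simp: X_def)
  also have "\<dots> = card (jump_class Q \<inter> {1..N})"
    unfolding card_jump_class[OF Q]
  proof (rule sum.cong[OF refl])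
    fix m assume "m \<in> {m. m \<in> {1..N} \<and> coprime m Q}"
    then have m: "m \<ge> 1" "coprime m Q" by auto
    have "m * s \<in> X \<longleftrightarrow> s \<in> B (N div m)" if s: "s \<in> core_divisors Q" for s
    proof -
      have pos: "s > 0" by (rule core_divisors_pos[OF Q s])
      have "m * s \<in> {1..N} \<longleftrightarrow> s \<le> N div m"
        using m pos by (auto simp: less_eq_div_iff_mult_less_eq mult.commute)
      then show ?thesis
        using B(1)[of "N div m"] gcd_core_divisor[OF s m(2)] pos
        by (auto simp: X_def cof_def S_def)
    qed
    then have "{s \<in> core_divisors Q. m * s \<in> X} = B (N div m)"
      using B(1)[of "N div m"] by (auto simp: S_def)
    then show "card {s \<in> core_divisors Q. m * s \<in> X} =
        gp3_max {s \<in> core_divisors Q. s \<le> N div m}"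
      using B(3) by (simp add: S_def)
  qed
  finally have card: "card X = card (jump_class Q \<inter> {1..N})" .
  have prod_dec: "(cof n * cof n') * (gcd n Q * gcd n' Q) = n * n'" for n n'
  proof -
    have "(cof n * cof n') * (gcd n Q * gcd n' Q) = (cof n * gcd n Q) * (cof n' * gcd n' Q)"
      by (simp only: ac_simps)
    then show ?thesis by (simp add: cof_def)
  qed
  have dec: "cof n * gcd n Q = n" for n by (simp add: cof_def)
  have sqf: "squarefree (cof n)" and cop: "coprime (cof n) Q" if "n \<in> X - E" for n
  proof -
    have n: "n > 0" "n \<le> N" using that by (auto simp: X_def)
    show cop: "coprime (cof n) Q"
      unfolding cof_def using that n by (intro coprime_cofactor Q core) auto
    have "\<not> l\<^sup>2 dvd cof n" if "prime l" for l
    proof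
      assume l: "l\<^sup>2 dvd cof n"
      then have "l dvd cof n" by (metis dvd_mult_left power2_eq_square)
      then have "\<not> l dvd Q" using cop that by (metis coprime_def not_prime_unit)
      moreover have "l * l dvd n" using l dec[of n] by (metis dvd_mult2 power2_eq_square)
      ultimately show False using \<open>n \<in> X - E\<close> that by (auto simp: E_def X_def)
    qed
    moreover have "cof n \<noteq> 0" using dec[of n] n by (metis mult_zero_left less_not_refl)
    ultimately show "squarefree (cof n)"
      by (auto simp: squarefree_factorial_semiring)
  qed
  have free: "gp3_free (X - E)"
    unfolding gp3_free_iff
  proof clarify
    fix x y z
    assume x: "x \<in> X" "x \<notin> E" and y: "y \<in> X" "y \<notin> E" and z: "z \<in> X" "z \<notin> E"
      and xy: "x < y" and eq: "y * y = x * z"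
    \<comment> \<open>Cofactors are coprime to all the gcds, so in \<open>y * y = x * z\<close> the
      cofactor parts and the gcd parts agree separately.\<close>
    have "coprime (cof x * cof z) (gcd y Q * gcd y Q)" "coprime (cof y * cof y) (gcd x Q * gcd z Q)"
      using cop[of x] cop[of y] cop[of z] x y z
      by (auto simp: coprime_mult_left_iff coprime_mult_right_iff
          intro: coprime_divisors[OF dvd_refl gcd_dvd2])
    moreover have "(cof x * cof z) * (gcd x Q * gcd z Q) = (cof y * cof y) * (gcd y Q * gcd y Q)"
      by (simp only: prod_dec eq)
    ultimately have cof_eq: "cof x * cof z = cof y * cof y"
      by (metis coprime_crossproduct_nat)
    then have same: "cof x = cof y" "cof z = cof y"
      using squarefree_cofactors_eq sqf x y z by (metis DiffI)+
    have pos: "cof y > 0" using y dec[of y] by (cases "cof y") (auto simp: X_def)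
    have "gcd x Q < gcd y Q" using xy dec[of x] dec[of y] same by (metis mult_less_cancel1)
    moreover have "gcd y Q * gcd y Q = gcd x Q * gcd z Q"
    proof -
      have "(cof y * cof y) * (gcd y Q * gcd y Q) = (cof y * cof y) * (gcd x Q * gcd z Q)"
        using eq prod_dec[of x z] prod_dec[of y y] by (simp only: same)
      then show ?thesis using pos by simp
    qed
    moreover have "gcd x Q \<in> B (N div cof y)" "gcd y Q \<in> B (N div cof y)" "gcd z Q \<in> B (N div cof y)"
      using x y z same by (auto simp: X_def)
    ultimately show False using B(2)[of "N div cof y"] unfolding gp3_free_iff by blast
  qed
  have "card (X - E) \<le> gp3_max {1..N}"
    using free by (intro card_le_gp3_max) (auto simp: X_def)
  moreover have "card X - card E \<le> card (X - E)"
    by (rule diff_card_le_card_Diff) (simp add: E_def)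
  ultimately show ?thesis using card by (simp add: E_def)
qed

subsection \<open>Size of the modulus and of the exceptional sets\<close>

lemma prod_primes_dvd:
  fixes m :: nat
  assumes "finite A" "\<And>p. p \<in> A \<Longrightarrow> prime p \<and> p dvd m"
  shows "\<Prod>A dvd m"
  using assms
proof (induction A rule: finite_induct)
  case (insert p A)
  have "coprime p (\<Prod>A)"
    using insert by (intro prod_coprime_right primes_coprime) auto
  then show ?case using insert by (simp add: divides_mult)
qed simp

text \<open>Such a prime divides \<open>fact (2 * n)\<close> but not \<open>fact n\<close>.\<close>

lemma prod_primes_dvd_central_binomial:
  "\<Prod>{p. prime p \<and> n < p \<and> p \<le> 2 * n} dvd (2 * n) choose n"
proof (rule prod_primes_dvd)
  show "finite {p. prime p \<and> n < p \<and> p \<le> 2 * n}"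
    by (rule finite_subset[of _ "{..2 * n}"]) auto
  fix p assume "p \<in> {p. prime p \<and> n < p \<and> p \<le> 2 * n}"
  then have p: "prime p" "n < p" "p \<le> 2 * n" by auto
  have "fact n * fact (2 * n - n) * ((2 * n) choose n) = fact (2 * n)"
    by (rule binomial_fact_lemma) simp
  then have "p dvd fact n * fact (2 * n - n) * ((2 * n) choose n)"
    using p by (simp add: prime_dvd_fact_iff)
  then show "prime p \<and> p dvd (2 * n) choose n"
    using p by (simp add: prime_dvd_mult_iff prime_dvd_fact_iff)
qed

lemma finite_primes_le [simp]: "finite {p :: nat. prime p \<and> p \<le> n}"
  by (rule finite_subset[of _ "{..n}"]) auto

text \<open>Each prime contributes a factor above \<open>2 ^ k\<close> to a divisor of the central
  binomial coefficient, which is at most \<open>2 ^ (2 * 2 ^ k)\<close>; then exponents of 2 are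
  compared.\<close>

lemma card_primes_dyadic:
  "k * card {p :: nat. prime p \<and> 2 ^ k < p \<and> p \<le> 2 * 2 ^ k} \<le> 2 * 2 ^ k"
proof -
  let ?n = "2 ^ k :: nat"
  let ?A = "{p :: nat. prime p \<and> ?n < p \<and> p \<le> 2 * ?n}"
  have "(2 :: nat) ^ (k * card ?A) = (\<Prod>p\<in>?A. ?n)"
    by (simp add: power_mult)
  also have "\<dots> \<le> \<Prod>?A" by (rule prod_mono) auto
  also have "\<dots> \<le> (2 * ?n) choose ?n"
    by (rule dvd_imp_le[OF prod_primes_dvd_central_binomial]) simp
  also have "\<dots> \<le> 2 ^ (2 * ?n)" by (rule binomial_le_pow2)
  finally show ?thesis by (rule power_le_imp_le_exp[rotated]) simp
qed

lemma card_primes_le: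
  "k * card {p :: nat. prime p \<and> p \<le> 2 ^ k} \<le> 6 * 2 ^ k"
proof (induction k)
  case (Suc k)
  let ?P = "{p :: nat. prime p \<and> p \<le> 2 ^ k}"
  let ?D = "{p :: nat. prime p \<and> 2 ^ k < p \<and> p \<le> 2 * 2 ^ k}"
  show ?case
  proof (cases "k \<ge> 2")
    case True
    have fin: "finite ?D" by (rule finite_subset[of _ "{..2 * 2 ^ k}"]) auto
    have "{p :: nat. prime p \<and> p \<le> 2 ^ Suc k} = ?P \<union> ?D" by auto
    then have "card {p :: nat. prime p \<and> p \<le> 2 ^ Suc k} = card ?P + card ?D"
      using fin by (simp add: card_Un_disjoint disjoint_iff)
    then have "k * card {p :: nat. prime p \<and> p \<le> 2 ^ Suc k} \<le> 8 * 2 ^ k"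
      using Suc card_primes_dyadic[of k] by (simp add: algebra_simps)
    \<comment> \<open>This uses \<open>2 * Suc k \<le> 3 * k\<close>, true from \<open>k = 2\<close>
      on. The constant 6 reproduces itself there because
      \<open>(6 + 2) * Suc k \<le> 12 * k\<close>.\<close>
    then have "2 * Suc k * (k * card {p :: nat. prime p \<and> p \<le> 2 ^ Suc k}) \<le> 3 * k * (8 * 2 ^ k)"
      by (rule mult_le_mono[rotated]) (use True in simp)
    then have "2 * k * (Suc k * card {p :: nat. prime p \<and> p \<le> 2 ^ Suc k}) \<le> 2 * k * (6 * 2 ^ Suc k)"
      by (simp add: algebra_simps)
    then show ?thesis using True by (simp only: mult_le_cancel1)
  next
    case False
    have "card {p :: nat. prime p \<and> p \<le> 2 ^ Suc k} \<le> card {..(2 :: nat) ^ Suc k}"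
      by (rule card_mono) auto
    moreover have "k = 0 \<or> k = 1" using False by auto
    ultimately show ?thesis by auto
  qed
qed simp

text \<open>The threshold \<open>K ^ 2\<close> makes the multiples of at most \<open>K\<close> such
  prime powers fill only a share \<open>1 / K\<close> of \<open>{1..N}\<close>; minimality keeps
  each power at most \<open>K ^ 3\<close> for \<open>p \<le> K\<close>.\<close>

definition prime_exponent :: "nat \<Rightarrow> nat \<Rightarrow> nat" where
  "prime_exponent K p = (LEAST a. K ^ 2 < p ^ a)"

definition sieve_modulus :: "nat \<Rightarrow> nat" where
  "sieve_modulus K = (\<Prod>p | prime p \<and> p \<le> K. p ^ prime_exponent K p)"

lemma less_prime_exponent:
  assumes "prime p" shows "K ^ 2 < p ^ prime_exponent K p"
  unfolding prime_exponent_def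
proof (rule LeastI)
  show "K ^ 2 < p ^ (K ^ 2)" using assms by (intro power_gt_expt) (auto dest: prime_gt_1_nat)
qed

lemma prime_exponent_pos:
  assumes "prime p" "K > 0" shows "0 < prime_exponent K p"
  using less_prime_exponent[OF assms(1), of K] assms(2) by (cases "prime_exponent K p") auto

lemma prime_power_exponent_le:
  assumes "prime p" "p \<le> K" shows "p ^ prime_exponent K p \<le> K ^ 3"
proof -
  have "K > 0" using assms by (auto dest: prime_gt_0_nat)
  then obtain b where b: "prime_exponent K p = Suc b"
    using prime_exponent_pos[OF assms(1)] by (metis gr0_conv_Suc)
  then have "\<not> K ^ 2 < p ^ b"
    unfolding prime_exponent_def by (intro not_less_Least) simp
  then have "p * p ^ b \<le> K * K ^ 2" using assms by (intro mult_le_mono) auto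
  then show ?thesis by (simp add: b eval_nat_numeral)
qed

lemma sieve_modulus_pos: "sieve_modulus K > 0"
  unfolding sieve_modulus_def by (rule prod_pos) (auto dest: prime_gt_0_nat)

lemma prime_dvd_sieve_modulus_iff:
  assumes "prime l" "K > 0" shows "l dvd sieve_modulus K \<longleftrightarrow> l \<le> K"
proof
  assume "l dvd sieve_modulus K"
  then obtain p where "prime p" "p \<le> K" "l dvd p ^ prime_exponent K p"
    unfolding sieve_modulus_def using assms by (auto simp: prime_dvd_prod_iff)
  then show "l \<le> K" using assms(1) by (metis prime_dvd_power primes_dvd_imp_eq)
next
  assume "l \<le> K"
  then have "l ^ prime_exponent K l dvd sieve_modulus K"
    unfolding sieve_modulus_def using assms by (intro dvd_prodI) auto
  then show "l dvd sieve_modulus K"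
    using prime_exponent_pos[OF assms] by (meson dvd_power dvd_trans)
qed

text \<open>Some prime \<open>p\<close> of the modulus cannot be multiplied onto the gcd, so the gcd
  already has the full exponent of \<open>p\<close>, and with it \<open>n\<close>.\<close>

lemma gcd_notin_core:
  assumes K: "K > 0" and notin: "gcd n (sieve_modulus K) \<notin> core_divisors (sieve_modulus K)"
  obtains p where "prime p" "p \<le> K" "p ^ prime_exponent K p dvd n"
proof -
  let ?Q = "sieve_modulus K"
  let ?s = "gcd n ?Q"
  obtain p where p: "prime p" "p dvd ?Q" and ndvd: "\<not> p * ?s dvd ?Q"
    using notin by (auto simp: core_divisors_def)
  have pK: "p \<le> K" using p K by (simp add: prime_dvd_sieve_modulus_iff)
  let ?a = "prime_exponent K p"
  let ?R = "\<Prod>q | q \<noteq> p \<and> prime q \<and> q \<le> K. q ^ prime_exponent K q"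
  have "{q. prime q \<and> q \<le> K} = insert p {q. q \<noteq> p \<and> prime q \<and> q \<le> K}"
    using p pK by auto
  then have Q: "?Q = p ^ ?a * ?R"
    unfolding sieve_modulus_def by (simp only:) (subst prod.insert, auto)
  have "p ^ ?a dvd n"
  proof (rule ccontr)
    assume nd: "\<not> p ^ ?a dvd n"
    have "?s \<noteq> 0" "\<not> is_unit p" using sieve_modulus_pos[of K] p by auto
    \<comment> \<open>\<open>y\<close> is the part of the gcd prime to \<open>p\<close>; it divides
      \<open>?R\<close>, so if the exponent of \<open>p\<close> were not full, one more factor
      \<open>p\<close> would still fit into \<open>?Q\<close>.\<close>
    then obtain y where y: "?s = p ^ multiplicity p ?s * y" "\<not> p dvd y"
      using multiplicity_decompose' by metis
    have "multiplicity p ?s < ?a"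
      using nd by (metis gcd_dvd1 dvd_trans multiplicity_dvd' not_le)
    then have "p ^ Suc (multiplicity p ?s) dvd p ^ ?a" by (intro le_imp_power_dvd) simp
    moreover have "y dvd ?R"
    proof -
      have "y dvd p ^ ?a * ?R" using y(1) Q by (metis dvd_triv_right gcd_dvd2 dvd_trans)
      moreover have "coprime y (p ^ ?a)"
        using y(2) p(1) by (simp add: coprime_commute prime_imp_coprime)
      ultimately show ?thesis by (simp add: coprime_dvd_mult_right_iff)
    qed
    ultimately have "p ^ Suc (multiplicity p ?s) * y dvd p ^ ?a * ?R" by (rule mult_dvd_mono)
    moreover have "p ^ Suc (multiplicity p ?s) * y = p * ?s" by (subst (2) y(1)) simp
    ultimately show False using ndvd Q by metis
  qed
  then show thesis using that p pK by blast
qed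

text \<open>Each prime contributes at most \<open>2 ^ (3 * k)\<close>, and
  \<open>card_primes_le\<close> bounds \<open>k\<close> times their number by
  \<open>6 * 2 ^ k\<close>; hence \<open>18 = 3 * 6\<close>.\<close>

lemma sieve_modulus_le: "sieve_modulus (2 ^ k) \<le> 2 ^ (18 * 2 ^ k)"
proof -
  let ?P = "{p :: nat. prime p \<and> p \<le> 2 ^ k}"
  have "sieve_modulus (2 ^ k) \<le> (\<Prod>p\<in>?P. (2 ^ k) ^ 3)"
    unfolding sieve_modulus_def by (rule prod_mono) (auto simp: prime_power_exponent_le)
  also have "\<dots> = 2 ^ (3 * (k * card ?P))"
    by (simp flip: power_mult add: mult_ac)
  also have "\<dots> \<le> 2 ^ (18 * 2 ^ k)"
    using card_primes_le[of k] by (intro power_increasing) auto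
  finally show ?thesis .
qed

section \<open>Counting the exceptional numbers\<close>

lemma card_multiples_le:
  assumes "d > 0" shows "real (card {n \<in> {1..N}. d dvd n}) \<le> real N / real d"
proof -
  have "{n \<in> {1..N}. d dvd n} \<subseteq> (\<lambda>k. d * k) ` {1..N div d}"
    using assms by (auto simp: image_iff less_eq_div_iff_mult_less_eq mult.commute elim!: dvdE)
  then have "card {n \<in> {1..N}. d dvd n} \<le> N div d"
    by (metis card_atLeastAtMost diff_Suc_1 finite_atLeastAtMost surj_card_le)
  then have "real (card {n \<in> {1..N}. d dvd n}) \<le> real (N div d)" by simp
  also have "\<dots> \<le> real N / real d" by (rule of_nat_div_le_of_nat)
  finally show ?thesis .
qed

text \<open>Union bound over at most \<open>K\<close> primes, each responsible for at most
  \<open>N / K ^ 2\<close> numbers by the choice of \<open>prime_exponent\<close>.\<close>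

lemma card_outside_core_le:
  assumes K: "K > 0"
  shows "real (card {n \<in> {1..N}. gcd n (sieve_modulus K) \<notin> core_divisors (sieve_modulus K)})
    \<le> real N / real K"
proof -
  let ?P = "{p :: nat. prime p \<and> p \<le> K}"
  have "{n \<in> {1..N}. gcd n (sieve_modulus K) \<notin> core_divisors (sieve_modulus K)} \<subseteq>
      (\<Union>p\<in>?P. {n \<in> {1..N}. p ^ prime_exponent K p dvd n})" (is "?E \<subseteq> _")
    using gcd_notin_core[OF K] by blast
  then have "card ?E \<le> (\<Sum>p\<in>?P. card {n \<in> {1..N}. p ^ prime_exponent K p dvd n})"
    by (intro order_trans[OF card_mono card_UN_le]) auto
  then have "real (card ?E) \<le> (\<Sum>p\<in>?P. real (card {n \<in> {1..N}. p ^ prime_exponent K p dvd n}))"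
    by (simp only: of_nat_sum[symmetric] of_nat_le_iff)
  also have "\<dots> \<le> (\<Sum>p\<in>?P. real N / real (K\<^sup>2))"
  proof (rule sum_mono)
    fix p assume "p \<in> ?P"
    then have p: "prime p" by simp
    have "real (card {n \<in> {1..N}. p ^ prime_exponent K p dvd n}) \<le> real N / real (p ^ prime_exponent K p)"
      using p by (intro card_multiples_le) (auto dest: prime_gt_0_nat)
    also have "\<dots> \<le> real N / real (K\<^sup>2)"
      using less_prime_exponent[OF p, of K] K prime_gt_0_nat[OF p]
      by (intro divide_left_mono mult_pos_pos) (simp_all del: of_nat_power)
    finally show "real (card {n \<in> {1..N}. p ^ prime_exponent K p dvd n}) \<le> real N / real (K\<^sup>2)" .
  qed
  also have "\<dots> = real (card ?P) * (real N / real (K\<^sup>2))" by simp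
  also have "\<dots> \<le> real K * (real N / real (K\<^sup>2))"
  proof -
    have "?P \<subseteq> {1..K}" by (auto dest: prime_ge_1_nat)
    then have "card ?P \<le> K" by (metis card_atLeastAtMost card_mono diff_Suc_1 finite_atLeastAtMost)
    then show ?thesis by (intro mult_right_mono) auto
  qed
  also have "\<dots> = real N / real K" using K by (simp add: power2_eq_square)
  finally show ?thesis .
qed

text \<open>The sum telescopes after \<open>1 / l ^ 2 \<le> 1 / (l - 1) - 1 / l\<close>.\<close>

lemma sum_inverse_squares_le:
  assumes "K > 0" shows "(\<Sum>l\<in>{K<..K + n}. 1 / (real l)\<^sup>2) \<le> 1 / K - 1 / (K + n)"
proof (induction n)
  case (Suc n)
  have "{K<..K + Suc n} = insert (K + Suc n) {K<..K + n}" by auto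
  then have "(\<Sum>l\<in>{K<..K + Suc n}. 1 / (real l)\<^sup>2) \<le>
      1 / K - 1 / (K + n) + 1 / (real (K + Suc n))\<^sup>2" using Suc by simp
  also have "1 / (real (K + Suc n))\<^sup>2 \<le> 1 / (real (K + Suc n) * real (K + n))"
    using assms by (intro divide_left_mono) (auto simp: power2_eq_square intro!: mult_left_mono mult_pos_pos)
  also have "\<dots> = 1 / (K + n) - 1 / (K + Suc n)"
    using assms by (simp add: field_simps)
  finally show ?case by (simp add: algebra_simps)
qed simp

text \<open>A prime not dividing the modulus exceeds \<open>K\<close>, so the union bound sums
  \<open>N / l ^ 2\<close> over \<open>l > K\<close>. The range may end at \<open>K + N\<close>
  because \<open>l * l dvd n\<close> implies \<open>l \<le> N\<close>.\<close>

lemma card_large_square_divisor_le: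
  assumes K: "K > 0"
  shows "real (card {n \<in> {1..N}. \<exists>l. prime l \<and> \<not> l dvd sieve_modulus K \<and> l * l dvd n})
    \<le> real N / real K"
proof -
  have "{n \<in> {1..N}. \<exists>l. prime l \<and> \<not> l dvd sieve_modulus K \<and> l * l dvd n} \<subseteq>
      (\<Union>l\<in>{K<..K + N}. {n \<in> {1..N}. l * l dvd n})" (is "?E \<subseteq> _")
  proof safe
    fix n l assume n: "n \<in> {1..N}" and l: "prime l" "\<not> l dvd sieve_modulus K" "l * l dvd n"
    have "K < l" using l K by (simp add: prime_dvd_sieve_modulus_iff)
    moreover have "l \<le> N" using n l(3) by (auto dest!: dvd_imp_le intro: order_trans[OF le_square])
    ultimately show "n \<in> (\<Union>l\<in>{K<..K + N}. {n \<in> {1..N}. l * l dvd n})"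
      using n l by (intro UN_I[of l]) auto
  qed
  then have "card ?E \<le> (\<Sum>l\<in>{K<..K + N}. card {n \<in> {1..N}. l * l dvd n})"
    by (intro order_trans[OF card_mono card_UN_le]) auto
  then have "real (card ?E) \<le> (\<Sum>l\<in>{K<..K + N}. real (card {n \<in> {1..N}. l * l dvd n}))"
    by (simp only: of_nat_sum[symmetric] of_nat_le_iff)
  also have "\<dots> \<le> (\<Sum>l\<in>{K<..K + N}. real N * (1 / (real l)\<^sup>2))"
  proof (rule sum_mono)
    fix l assume "l \<in> {K<..K + N}"
    then show "real (card {n \<in> {1..N}. l * l dvd n}) \<le> real N * (1 / (real l)\<^sup>2)"
      using card_multiples_le[of "l * l" N] by (simp add: power2_eq_square)
  qed
  also have "\<dots> = real N * (\<Sum>l\<in>{K<..K + N}. 1 / (real l)\<^sup>2)" by (simp add: sum_distrib_left)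
  also have "\<dots> \<le> real N * (1 / K)"
    using sum_inverse_squares_le[OF K, of N]
    by (intro mult_left_mono) (auto intro: order_trans)
  finally show ?thesis by simp
qed

lemma card_jump_class_add:
  "card (jump_class Q \<inter> {1..N + Q}) = card (jump_class Q \<inter> {1..N}) + card (jump_class Q \<inter> {1..Q})"
proof -
  have shift: "n + Q \<in> jump_class Q \<longleftrightarrow> n \<in> jump_class Q" for n by (simp add: jump_class_def)
  have "jump_class Q \<inter> {1..N + Q} =
      (jump_class Q \<inter> {1..Q}) \<union> (\<lambda>n. n + Q) ` (jump_class Q \<inter> {1..N})" (is "?L = ?R")
  proof (intro equalityI subsetI)
    fix x assume x: "x \<in> ?L"
    show "x \<in> ?R"
    proof (cases "x \<le> Q")
      case False
      then have "x = (x - Q) + Q" "x - Q \<in> jump_class Q \<inter> {1..N}"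
        using x shift[of "x - Q"] by auto
      then show ?thesis by blast
    qed (use x in auto)
  qed (auto simp: shift)
  moreover have "card ((\<lambda>n. n + Q) ` (jump_class Q \<inter> {1..N})) = card (jump_class Q \<inter> {1..N})"
    by (rule card_image) simp
  moreover have "(jump_class Q \<inter> {1..Q}) \<inter> (\<lambda>n. n + Q) ` (jump_class Q \<inter> {1..N}) = {}" by auto
  ultimately show ?thesis by (simp add: card_Un_disjoint)
qed

section \<open>Densities of the periodic set and of optimal sets\<close>

definition jump_density :: "nat \<Rightarrow> real" where
  "jump_density Q = card (jump_class Q \<inter> {1..Q}) / Q"

lemma card_Int_interval_le: "card (X \<inter> {1..n}) \<le> n" for n :: nat
  by (metis Int_lower2 card_atLeastAtMost card_mono diff_Suc_1 finite_atLeastAtMost)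

text \<open>Removing a full period changes both terms equally, so only \<open>N < Q\<close> matters,
  where both lie between 0 and \<open>N\<close>.\<close>

lemma card_jump_class_approx:
  assumes Q: "Q > 0"
  shows "\<bar>real (card (jump_class Q \<inter> {1..N})) - jump_density Q * N\<bar> \<le> Q"
proof (induction N rule: less_induct)
  case (less N)
  show ?case
  proof (cases "N < Q")
    case True
    have "jump_density Q \<le> 1"
      unfolding jump_density_def using card_Int_interval_le[of "jump_class Q" Q] Q by simp
    then have "jump_density Q * real N \<le> 1 * real N" by (rule mult_right_mono) simp
    moreover have "0 \<le> jump_density Q * real N" by (simp add: jump_density_def)
    ultimately
    show ?thesis using card_Int_interval_le[of "jump_class Q" N] True by (auto simp: abs_le_iff)
  next
    case False
    then obtain M where M: "N = M + Q" by (metis add.commute le_Suc_ex not_less)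
    have "real (card (jump_class Q \<inter> {1..Q})) = jump_density Q * Q"
      using Q by (simp add: jump_density_def)
    then show ?thesis
      using less[of M] Q card_jump_class_add[of Q M] by (simp add: M algebra_simps)
  qed
qed

definition max_density :: "nat \<Rightarrow> real" where
  "max_density N = real (gp3_max {1..N}) / real N"

text \<open>The upper estimate loses only the numbers outside the core, the lower one only those
  with a large square divisor. The two errors do not add up, hence \<open>1 / K\<close> and not
  \<open>2 / K\<close>.\<close>

lemma max_density_approx:
  assumes K: "K > 0" and N: "N > 0"
  shows "\<bar>max_density N - jump_density (sieve_modulus K)\<bar> \<le> 1 / K + real (sieve_modulus K) / N"
proof -
  let ?Q = "sieve_modulus K"
  let ?c = "real (card (jump_class ?Q \<inter> {1..N}))"
  have Q: "?Q > 0" by (rule sieve_modulus_pos)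
  have "real (gp3_max {1..N}) \<le> ?c + real N / real K"
    using gp3_max_le_jump_class[OF Q, of N] card_outside_core_le[OF K, of N] by linarith
  moreover have "?c \<le> real (gp3_max {1..N}) + real N / real K"
    using jump_class_le_gp3_max[OF Q, of N] card_large_square_divisor_le[OF K, of N] by linarith
  ultimately have "\<bar>real (gp3_max {1..N}) - jump_density ?Q * N\<bar> \<le> real N / real K + ?Q"
    using card_jump_class_approx[OF Q, of N] by linarith
  then have "\<bar>real (gp3_max {1..N}) - jump_density ?Q * N\<bar> / N \<le> (real N / real K + ?Q) / N"
    by (intro divide_right_mono) auto
  moreover have "max_density N - jump_density ?Q = (real (gp3_max {1..N}) - jump_density ?Q * N) / N"
    using N by (simp add: max_density_def diff_divide_distrib)
  ultimately show ?thesis using N by (simp add: add_divide_distrib abs_divide)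
qed

subsection \<open>Convergence to the supremum of the upper densities\<close>

lemma sieve_error_tendsto: "(\<lambda>N. 1 / real K + real Q / real N) \<longlonglongrightarrow> 1 / real K"
proof -
  have "(\<lambda>N. 1 / real K + real Q * (1 / real N)) \<longlonglongrightarrow> 1 / real K + real Q * 0"
    by (intro tendsto_intros lim_1_over_n)
  then show ?thesis by simp
qed

text \<open>For fixed \<open>K\<close> all late terms are close to the same
  \<open>jump_density (sieve_modulus K)\<close>, hence to each other.\<close>

lemma convergent_max_density: "convergent max_density"
proof (rule Cauchy_convergent, rule CauchyI)
  fix e :: real assume e: "0 < e"
  obtain K where K: "0 < K" "1 / real K < e / 2"
    using reals_Archimedean[of "e / 2"] e by (metis half_gt_zero inverse_eq_divide zero_less_Suc)
  let ?err = "\<lambda>N. 1 / real K + real (sieve_modulus K) / real N"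
  have "eventually (\<lambda>N. ?err N < e / 2) sequentially"
    by (rule order_tendstoD(2)[OF sieve_error_tendsto K(2)])
  then obtain N0 where N0: "\<And>N. N \<ge> N0 \<Longrightarrow> ?err N < e / 2"
    by (auto simp: eventually_sequentially)
  \<comment> \<open>\<open>Suc N0\<close> keeps the index positive, as
    \<open>max_density_approx\<close> demands.\<close>
  have "norm (max_density m - max_density n) < e" if "m \<ge> Suc N0" "n \<ge> Suc N0" for m n
  proof -
    have "\<bar>max_density k - jump_density (sieve_modulus K)\<bar> < e / 2" if "k \<ge> Suc N0" for k
      using max_density_approx[OF K(1), of k] N0[of k] that by linarith
    from this[OF that(1)] this[OF that(2)] show ?thesis unfolding real_norm_def by argo
  qed
  then show "\<exists>M. \<forall>m\<ge>M. \<forall>n\<ge>M. norm (max_density m - max_density n) < e" by blast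
qed

text \<open>Each end is the fourth power of the previous one. This leaves room for both comparisons
  in \<open>gp3_free_blocks\<close>, with \<open>R * R\<close> times an earlier end and with
  \<open>R\<close> times its square.\<close>

definition block_end :: "nat \<Rightarrow> nat \<Rightarrow> nat" where
  "block_end R j = R ^ (4 ^ j)"

lemma block_end_growth:
  assumes R: "R \<ge> 2" and "a < b"
  shows "R * block_end R a \<le> block_end R b" "R * R * block_end R a \<le> block_end R b"
    "R * (block_end R a * block_end R a) \<le> block_end R b"
proof -
  have "4 * 4 ^ a \<le> (4 :: nat) ^ b"
    using assms(2) by (metis Suc_leI numeral_le_iff power_Suc power_increasing one_le_numeral)
  then have le: "R ^ n \<le> block_end R b" if "n \<le> 4 * 4 ^ a" for n
    unfolding block_end_def using R that by (intro power_increasing) auto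
  have q: "(1 :: nat) \<le> 4 ^ a" by simp
  have "Suc (4 ^ a) \<le> 4 * 4 ^ a" "Suc (Suc (4 ^ a)) \<le> 4 * 4 ^ a" "Suc (2 * 4 ^ a) \<le> (4 :: nat) * 4 ^ a"
    using q by linarith+
  from this[THEN le] show "R * block_end R a \<le> block_end R b" "R * R * block_end R a \<le> block_end R b"
    "R * (block_end R a * block_end R a) \<le> block_end R b"
    unfolding block_end_def power_Suc mult_2 power_add by (simp_all add: mult.assoc)
qed

text \<open>If \<open>z\<close> lay in a later block than \<open>y\<close>, it would exceed the
  square of the end of block \<open>b\<close>, although \<open>z \<le> x * z = y * y\<close>. If
  only \<open>x\<close> lay in an earlier block, \<open>x * z\<close> would be too small, since
  \<open>y\<close> exceeds its block end divided by \<open>R\<close>.\<close>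

lemma gp3_free_blocks:
  assumes R: "R \<ge> 2" and B: "\<And>j. B j \<subseteq> {1..block_end R j}" "\<And>j. gp3_free (B j)"
  shows "gp3_free (\<Union>j. {n \<in> B j. block_end R j < R * n})"
  unfolding gp3_free_iff
proof clarify
  fix x y z a b c
  assume x: "x \<in> B a" "block_end R a < R * x" and y: "y \<in> B b" "block_end R b < R * y"
    and z: "z \<in> B c" "block_end R c < R * z" and xy: "x < y" and eq: "y * y = x * z"
  have bd: "1 \<le> x" "x \<le> block_end R a" "y \<le> block_end R b" "z \<le> block_end R c"
    using x y z B by fastforce+
  have yz: "y < z"
  proof (rule ccontr)
    assume "\<not> y < z"
    then have "x * z \<le> x * y" by simp
    also have "\<dots> < y * y" using xy by simp
    finally have "x * z < y * y" .
    then show False using eq by simp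
  qed
  have mono: "j \<le> i" if "u \<le> v" "block_end R j < R * u" "v \<le> block_end R i" for u v i j
  proof (rule ccontr)
    assume "\<not> j \<le> i"
    then have "R * block_end R i \<le> block_end R j" using R by (intro block_end_growth) auto
    moreover have "R * u \<le> R * block_end R i" using that by simp
    ultimately show False using that by linarith
  qed
  have ab: "a \<le> b" and bc: "b \<le> c"
    using mono[of x y a b] mono[of y z b c] x y z xy yz bd by auto
  have "b = c"
  proof (rule ccontr)
    assume "b \<noteq> c"
    then have "R * (block_end R b * block_end R b) \<le> block_end R c"
      using R bc by (intro block_end_growth) auto
    moreover have "z \<le> block_end R b * block_end R b"
    proof -
      have "z \<le> x * z" using bd by simp
      also have "\<dots> \<le> block_end R b * block_end R b" unfolding eq[symmetric] using bd by (intro mult_le_mono)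
      finally show ?thesis .
    qed
    then have "R * z \<le> R * (block_end R b * block_end R b)" by simp
    ultimately show False using z by linarith
  qed
  moreover have "a = b"
  proof (rule ccontr)
    assume "a \<noteq> b"
    then have "R * R * block_end R a \<le> block_end R b" using R ab by (intro block_end_growth) auto
    then have "R * R * block_end R a * block_end R b \<le> block_end R b * block_end R b" by simp
    also have "\<dots> < (R * y) * (R * y)" using y R xy by (intro mult_strict_mono) auto
    also have "\<dots> = R * R * (x * z)" by (simp add: eq[symmetric])
    also have "\<dots> \<le> R * R * (block_end R a * block_end R b)"
      using bd \<open>b = c\<close> by (intro mult_le_mono) auto
    finally show False by simp
  qed
  ultimately show False using x y z xy eq B(2)[of b] unfolding gp3_free_iff by blast
qed

lemma upper_density_le:
  assumes A: "gp3_free A" and lim: "max_density \<longlonglongrightarrow> L"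
  shows "upper_density A \<le> L"
proof -
  let ?f = "\<lambda>N. ereal (real (card (A \<inter> {1..N})) / real N)"
  have "?f N \<le> ereal (max_density N)" for N
  proof -
    have "card (A \<inter> {1..N}) \<le> gp3_max {1..N}"
      using gp3_free_subset[OF A] by (intro card_le_gp3_max) auto
    then show ?thesis by (simp add: max_density_def divide_right_mono)
  qed
  then have "limsup ?f \<le> limsup (\<lambda>N. ereal (max_density N))"
    by (intro Limsup_mono always_eventually) auto
  also have "\<dots> = ereal L"
    using lim by (intro lim_imp_Limsup) auto
  finally have "limsup ?f \<le> ereal L" .
  \<comment> \<open>Bounded on both sides, the upper limit is finite, so
    \<open>real_of_ereal\<close> returns its value and not the default 0.\<close>
  moreover have "0 \<le> limsup ?f"
    by (rule le_Limsup) (auto intro!: always_eventually)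
  ultimately show ?thesis
    unfolding upper_density_def by (cases "limsup ?f") auto
qed

lemma upper_density_ge:
  assumes A: "gp3_free A" and r: "strict_mono r" and c: "c \<longlonglongrightarrow> L"
    and ge: "\<And>j. c j \<le> real (card (A \<inter> {1..r j})) / real (r j)"
    and lim: "max_density \<longlonglongrightarrow> L'"
  shows "L \<le> upper_density A"
proof -
  let ?f = "\<lambda>N. ereal (real (card (A \<inter> {1..N})) / real N)"
  have "ereal L = limsup (\<lambda>j. ereal (c j))"
    using c by (intro lim_imp_Limsup[symmetric]) auto
  also have "\<dots> \<le> limsup (?f \<circ> r)"
    using ge by (intro Limsup_mono always_eventually) auto
  also have "\<dots> \<le> limsup ?f" by (rule limsup_subseq_mono[OF r])
  finally have "ereal L \<le> limsup ?f" .
  moreover have "?f N \<le> 1" for N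
    using card_Int_interval_le[of A N] by (auto simp: divide_le_eq_1)
  then have "limsup ?f \<le> 1"
    by (intro Limsup_bounded always_eventually) auto
  ultimately show ?thesis
    unfolding upper_density_def by (cases "limsup ?f") auto
qed

lemma dense_gp3_free:
  assumes R: "R \<ge> 2" and lim: "max_density \<longlonglongrightarrow> L"
  obtains A where "A \<subseteq> {1..}" "gp3_free A" "L - 1 / real R \<le> upper_density A"
proof -
  have "\<forall>j. \<exists>B. B \<subseteq> {1..block_end R j} \<and> gp3_free B \<and> card B = gp3_max {1..block_end R j}"
    using gp3_max_attained[OF finite_atLeastAtMost] by metis
  then obtain B where B: "\<And>j. B j \<subseteq> {1..block_end R j}" "\<And>j. gp3_free (B j)"
    "\<And>j. card (B j) = gp3_max {1..block_end R j}" by metis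
  define A where "A = (\<Union>j. {n \<in> B j. block_end R j < R * n})"
  have free: "gp3_free A" unfolding A_def by (rule gp3_free_blocks[OF R B(1,2)])
  have sub: "A \<subseteq> {1..}" unfolding A_def using B(1) by fastforce
  have mono: "strict_mono (block_end R)"
    unfolding block_end_def using R by (auto simp: strict_mono_def intro!: power_strict_increasing)
  have ge: "max_density (block_end R j) - 1 / real R \<le>
      real (card (A \<inter> {1..block_end R j})) / real (block_end R j)" for j
  proof -
    let ?N = "block_end R j"
    have pos: "?N > 0" using R by (simp add: block_end_def)
    \<comment> \<open>Up to a block end, \<open>A\<close> contains the optimal set of that block
      except for its elements up to \<open>?N div R\<close>, which cost a density of at most
      \<open>1 / R\<close>.\<close>
    have "B j - {1..?N div R} \<subseteq> A \<inter> {1..?N}"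
    proof
      fix n assume n: "n \<in> B j - {1..?N div R}"
      then have "n \<in> {1..?N}" using B(1)[of j] by blast
      moreover from this n have "?N div R < n" by auto
      then have "?N < R * n" using R by (simp add: div_less_iff_less_mult mult.commute)
      ultimately show "n \<in> A \<inter> {1..?N}" using n by (auto simp: A_def)
    qed
    then have "card (B j - {1..?N div R}) \<le> card (A \<inter> {1..?N})" by (intro card_mono) auto
    moreover have "card (B j) - card {1..?N div R} \<le> card (B j - {1..?N div R})"
      by (rule diff_card_le_card_Diff) simp
    ultimately have "gp3_max {1..?N} \<le> card (A \<inter> {1..?N}) + ?N div R" using B(3)[of j] by simp
    then have "real (gp3_max {1..?N}) \<le> real (card (A \<inter> {1..?N})) + real (?N div R)" by simp
    also have "real (?N div R) \<le> real ?N / real R" by (rule of_nat_div_le_of_nat)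
    finally have "real (gp3_max {1..?N}) / ?N \<le> (real (card (A \<inter> {1..?N})) + real ?N / real R) / ?N"
      by (intro divide_right_mono) auto
    then show ?thesis using pos by (simp add: max_density_def add_divide_distrib)
  qed
  have "(\<lambda>j. max_density (block_end R j) - 1 / real R) \<longlonglongrightarrow> L - 1 / real R"
    using LIMSEQ_subseq_LIMSEQ[OF lim mono] by (intro tendsto_intros) (simp add: o_def)
  from upper_density_ge[OF free mono this ge lim]
  show thesis using that sub free by blast
qed

text \<open>The limit bounds every upper density by \<open>upper_density_le\<close>, and
  \<open>dense_gp3_free\<close> comes within \<open>1 / R\<close> of it for every
  \<open>R \<ge> 2\<close>.\<close>

lemma max_density_tendsto_alpha_bar: "max_density \<longlonglongrightarrow> alpha_bar"
proof -
  obtain L where L: "max_density \<longlonglongrightarrow> L"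
    using convergent_max_density by (auto simp: convergent_def)
  let ?F = "{A. A \<subseteq> {1..} \<and> gp3_free A}"
  have "alpha_bar \<le> L"
    unfolding alpha_bar_def using upper_density_le[OF _ L] by (intro cSUP_least) auto
  moreover have bdd: "bdd_above (upper_density ` ?F)"
    using upper_density_le[OF _ L] by (auto simp: bdd_above_def)
  have "L - alpha_bar \<le> 1 / real (Suc (Suc n))" for n
  proof -
    obtain A where "A \<in> ?F" "L - 1 / real (Suc (Suc n)) \<le> upper_density A"
      using dense_gp3_free[OF _ L, of "Suc (Suc n)"] by auto
    moreover have "upper_density A \<le> alpha_bar"
      unfolding alpha_bar_def using bdd \<open>A \<in> ?F\<close> by (intro cSUP_upper)
    ultimately show ?thesis by linarith
  qed
  then have "L - alpha_bar \<le> 0"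
    by (intro LIMSEQ_le_const[OF LIMSEQ_ignore_initial_segment[OF lim_1_over_n, of 2]]) auto
  ultimately show ?thesis using L by simp
qed

text \<open>Letting \<open>N\<close> tend to infinity in \<open>max_density_approx\<close> places
  \<open>alpha_bar\<close> within \<open>1 / K\<close> of the jump density; the triangle inequality
  does the rest.\<close>

lemma max_density_alpha_bar:
  assumes K: "K > 0" and N: "N > 0"
  shows "\<bar>max_density N - alpha_bar\<bar> \<le> 2 / K + real (sieve_modulus K) / N"
proof -
  let ?J = "jump_density (sieve_modulus K)"
  have "\<bar>alpha_bar - ?J\<bar> \<le> 1 / K"
  proof (rule tendsto_le[OF _ sieve_error_tendsto])
    show "(\<lambda>N. \<bar>max_density N - ?J\<bar>) \<longlonglongrightarrow> \<bar>alpha_bar - ?J\<bar>"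
      by (intro tendsto_intros max_density_tendsto_alpha_bar)
    show "eventually (\<lambda>N. \<bar>max_density N - ?J\<bar> \<le> 1 / K + real (sieve_modulus K) / N) sequentially"
      using max_density_approx[OF K] by (intro eventually_sequentiallyI[of 1]) auto
  qed simp
  then show ?thesis using max_density_approx[OF K N] by linarith
qed

text \<open>With \<open>K = 2 ^ (i + 3)\<close> the modulus is at most \<open>2 ^ (18 * K)\<close>,
  so \<open>N = 2 ^ (19 * K)\<close> makes the last error term less than \<open>1 / K\<close>; this
  explains \<open>152 = 19 * 8\<close>. The total is below \<open>3 / K\<close>, and the claim
  allows \<open>4 / K\<close>.\<close>

lemma max_density_exp_approx:
  "\<bar>max_density (2 ^ (152 * 2 ^ i)) - alpha_bar\<bar> < 1 / 2 ^ Suc i"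
proof -
  let ?K = "2 ^ (i + 3) :: nat"
  have "\<bar>max_density (2 ^ (152 * 2 ^ i)) - alpha_bar\<bar> \<le>
      2 / ?K + real (sieve_modulus ?K) / real (2 ^ (152 * 2 ^ i))"
    by (rule max_density_alpha_bar) auto
  also have "real (sieve_modulus ?K) / real (2 ^ (152 * 2 ^ i)) < 1 / ?K"
  proof -
    have "?K < 2 ^ ?K" by (rule less_exp)
    then have "sieve_modulus ?K * ?K < 2 ^ (18 * ?K) * 2 ^ ?K"
      using sieve_modulus_le[of "i + 3"] by (intro mult_le_less_imp_less sieve_modulus_pos) auto
    also have "\<dots> = 2 ^ (152 * 2 ^ i)" by (simp flip: power_add add: power_add)
    finally have "real (sieve_modulus ?K) * real ?K < real (2 ^ (152 * 2 ^ i))"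
      by (metis of_nat_less_iff of_nat_mult)
    then show ?thesis by (simp add: field_simps)
  qed
  finally show ?thesis by (simp add: power_add field_simps)
qed

subsection \<open>Compiling loop expressions to the random access machine\<close>

text \<open>Variables are de Bruijn indices. The body of \<open>Fold n a b\<close> is run \<open>n\<close> times and sees the accumulator,
  started at \<open>a\<close>, as variable 0 and the index, counting up from 0, as variable 1.\<close>

datatype expr =
    Var nat
  | Lit nat
  | Plus expr expr
  | Monus expr expr
  | Bind expr expr
  | Fold expr expr expr

primrec eval :: "expr \<Rightarrow> (nat \<Rightarrow> nat) \<Rightarrow> nat" where
  "eval (Var i) env = env i"
| "eval (Lit n) env = n"
| "eval (Plus a b) env = eval a env + eval b env"
| "eval (Monus a b) env = eval a env - eval b env"
| "eval (Bind a b) env = eval b (case_nat (eval a env) env)"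
| "eval (Fold n a b) env =
    rec_nat (eval a env) (\<lambda>k v. eval b (case_nat v (case_nat k env))) (eval n env)"

text \<open>Exact step counts of the compiled code. In \<open>Fold\<close>, 6 is the loop test and
  five bookkeeping instructions per round; 4 is the reset of the index, the last test and the final
  move. \<open>eval (Fold (Lit k) a b) env\<close> is the accumulator after \<open>k\<close>
  rounds.\<close>

primrec cost :: "expr \<Rightarrow> (nat \<Rightarrow> nat) \<Rightarrow> nat" where
  "cost (Var i) env = 2"
| "cost (Lit n) env = 1"
| "cost (Plus a b) env = cost a env + cost b env + 1"
| "cost (Monus a b) env = cost a env + cost b env + 1"
| "cost (Bind a b) env = cost a env + cost b (case_nat (eval a env) env) + 2"
| "cost (Fold n a b) env = cost n env + cost a env +
    (\<Sum>k<eval n env. cost b (case_nat (eval (Fold (Lit k) a b) env) (case_nat k env)) + 6) + 4"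

text \<open>Variable \<open>i\<close> lives in register \<open>\<rho> i < d\<close>; the result goes to register \<open>d\<close>, and no register below
  \<open>d\<close> is changed.\<close>

primrec compile :: "expr \<Rightarrow> (nat \<Rightarrow> nat) \<Rightarrow> nat \<Rightarrow> ram_prog" where
  "compile (Var i) \<rho> d = Seq (Const d 0) (Add d d (\<rho> i))"
| "compile (Lit n) \<rho> d = Const d n"
| "compile (Plus a b) \<rho> d = Seq (compile a \<rho> d) (Seq (compile b \<rho> (d + 1)) (Add d d (d + 1)))"
| "compile (Monus a b) \<rho> d = Seq (compile a \<rho> d) (Seq (compile b \<rho> (d + 1)) (Sub d d (d + 1)))"
| "compile (Bind a b) \<rho> d = Seq (compile a \<rho> d) (Seq (compile b (case_nat d \<rho>) (d + 1))
    (Seq (Const d 0) (Add d d (d + 1))))"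
| "compile (Fold n a b) \<rho> d = Seq (compile n \<rho> d) (Seq (compile a \<rho> (d + 1)) (Seq (Const (d + 2) 0)
    (Seq (WhileNZ d (Seq (compile b (case_nat (d + 1) (case_nat (d + 2) \<rho>)) (d + 3))
      (Seq (Const (d + 1) 0) (Seq (Add (d + 1) (d + 1) (d + 3)) (Seq (Const (d + 3) 1)
      (Seq (Add (d + 2) (d + 2) (d + 3)) (Sub d d (d + 3))))))))
    (Seq (Const d 0) (Add d d (d + 1))))))"

lemma ram_exec_ConstI: "t = 1 \<Longrightarrow> s' = s\<lparr>regs := (regs s)(x := n)\<rparr> \<Longrightarrow> ram_exec dg (Const x n) s t s'"
  by (simp add: ram_exec.Const[simplified])

lemma ram_exec_AddI:
  "t = 1 \<Longrightarrow> s' = s\<lparr>regs := (regs s)(x := regs s y + regs s z)\<rparr> \<Longrightarrow> ram_exec dg (Add x y z) s t s'"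
  by (simp add: ram_exec.Add[simplified])

lemma ram_exec_SubI:
  "t = 1 \<Longrightarrow> s' = s\<lparr>regs := (regs s)(x := regs s y - regs s z)\<rparr> \<Longrightarrow> ram_exec dg (Sub x y z) s t s'"
  by (simp add: ram_exec.Sub[simplified])

lemma ram_exec_InputI:
  "t = 1 \<Longrightarrow> s' = s\<lparr>regs := (regs s)(x := of_bool (dg (regs s y)))\<rparr> \<Longrightarrow> ram_exec dg (Input x y) s t s'"
  by (simp add: ram_exec.Input[simplified])

lemma ram_exec_SeqI:
  "ram_exec dg c1 s t1 s1 \<Longrightarrow> ram_exec dg c2 s1 t2 s2 \<Longrightarrow> t = t1 + t2 \<Longrightarrow> ram_exec dg (Seq c1 c2) s t s2"
  by (simp add: ram_exec.Seq)

lemma ram_exec_move: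
  assumes "x \<noteq> y"
  shows "ram_exec dg (Seq (Const x 0) (Add x x y)) s 2 (s\<lparr>regs := (regs s)(x := regs s y)\<rparr>)"
  by (rule ram_exec_SeqI, rule ram_exec_ConstI[OF refl refl], rule ram_exec_AddI[OF refl])
    (use assms in simp_all)

text \<open>Code compiled for target \<open>d\<close> keeps all lower registers, so variables and
  earlier intermediate results survive when later subterms use higher targets.\<close>

theorem compile_correct:
  assumes "\<forall>i. \<rho> i < d" "\<forall>i. regs s (\<rho> i) = env i"
  shows "\<exists>s'. ram_exec dg (compile e \<rho> d) s (cost e env) s' \<and> regs s' d = eval e env \<and>
    (\<forall>j<d. regs s' j = regs s j)"
  using assms
proof (induction e arbitrary: \<rho> d env s)
  case (Var i)
  then have "\<rho> i < d" "regs s (\<rho> i) = env i" by auto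
  then show ?case
    using ram_exec_move[of d "\<rho> i" dg s]
    by (intro exI[of _ "s\<lparr>regs := (regs s)(d := regs s (\<rho> i))\<rparr>"]) simp
next
  case (Lit n)
  show ?case
    using ram_exec.Const[of dg d n s] by (intro exI[of _ "s\<lparr>regs := (regs s)(d := n)\<rparr>"]) simp
next
  case (Plus a b)
  from Plus.IH(1)[OF Plus.prems] obtain s1 where
    1: "ram_exec dg (compile a \<rho> d) s (cost a env) s1" "regs s1 d = eval a env"
       "\<And>j. j < d \<Longrightarrow> regs s1 j = regs s j" by blast
  have "\<exists>s'. ram_exec dg (compile b \<rho> (d + 1)) s1 (cost b env) s' \<and> regs s' (d + 1) = eval b env \<and>
    (\<forall>j<d + 1. regs s' j = regs s1 j)"
    using Plus.prems 1(3) by (intro Plus.IH(2)) (auto simp: less_SucI)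
  then obtain s2 where 2: "ram_exec dg (compile b \<rho> (d + 1)) s1 (cost b env) s2"
    "regs s2 (d + 1) = eval b env" "\<And>j. j < d + 1 \<Longrightarrow> regs s2 j = regs s1 j" by blast
  let ?s3 = "s2\<lparr>regs := (regs s2)(d := regs s2 d + regs s2 (d + 1))\<rparr>"
  have "ram_exec dg (compile (Plus a b) \<rho> d) s (cost (Plus a b) env) ?s3"
    unfolding compile.simps
    by (rule ram_exec_SeqI[OF 1(1)], rule ram_exec_SeqI[OF 2(1)], rule ram_exec_AddI[OF refl refl]) auto
  then show ?case using 1 2 by (intro exI[of _ ?s3]) auto
next
  case (Monus a b)
  from Monus.IH(1)[OF Monus.prems] obtain s1 where
    1: "ram_exec dg (compile a \<rho> d) s (cost a env) s1" "regs s1 d = eval a env"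
       "\<And>j. j < d \<Longrightarrow> regs s1 j = regs s j" by blast
  have "\<exists>s'. ram_exec dg (compile b \<rho> (d + 1)) s1 (cost b env) s' \<and> regs s' (d + 1) = eval b env \<and>
    (\<forall>j<d + 1. regs s' j = regs s1 j)"
    using Monus.prems 1(3) by (intro Monus.IH(2)) (auto simp: less_SucI)
  then obtain s2 where 2: "ram_exec dg (compile b \<rho> (d + 1)) s1 (cost b env) s2"
    "regs s2 (d + 1) = eval b env" "\<And>j. j < d + 1 \<Longrightarrow> regs s2 j = regs s1 j" by blast
  let ?s3 = "s2\<lparr>regs := (regs s2)(d := regs s2 d - regs s2 (d + 1))\<rparr>"
  have "ram_exec dg (compile (Monus a b) \<rho> d) s (cost (Monus a b) env) ?s3"
    unfolding compile.simps
    by (rule ram_exec_SeqI[OF 1(1)], rule ram_exec_SeqI[OF 2(1)], rule ram_exec_SubI[OF refl refl]) auto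
  then show ?case using 1 2 by (intro exI[of _ ?s3]) auto
next
  case (Bind a b)
  from Bind.IH(1)[OF Bind.prems] obtain s1 where
    1: "ram_exec dg (compile a \<rho> d) s (cost a env) s1" "regs s1 d = eval a env"
       "\<And>j. j < d \<Longrightarrow> regs s1 j = regs s j" by blast
  let ?env = "case_nat (eval a env) env"
  have "\<exists>s'. ram_exec dg (compile b (case_nat d \<rho>) (d + 1)) s1 (cost b ?env) s' \<and>
    regs s' (d + 1) = eval b ?env \<and> (\<forall>j<d + 1. regs s' j = regs s1 j)"
    using Bind.prems 1(2,3) by (intro Bind.IH(2)) (auto simp: less_SucI split: nat.split)
  then obtain s2 where 2: "ram_exec dg (compile b (case_nat d \<rho>) (d + 1)) s1 (cost b ?env) s2"
    "regs s2 (d + 1) = eval b ?env" "\<And>j. j < d + 1 \<Longrightarrow> regs s2 j = regs s1 j" by blast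
  let ?s3 = "s2\<lparr>regs := (regs s2)(d := regs s2 (d + 1))\<rparr>"
  have "ram_exec dg (compile (Bind a b) \<rho> d) s (cost (Bind a b) env) ?s3"
    unfolding compile.simps
    by (rule ram_exec_SeqI[OF 1(1)], rule ram_exec_SeqI[OF 2(1)], rule ram_exec_move) auto
  then show ?case using 1 2 by (intro exI[of _ ?s3]) auto
next
  case (Fold n a b)
  define acc where "acc k = eval (Fold (Lit k) a b) env" for k
  define env' where "env' k = case_nat (acc k) (case_nat k env)" for k
  define \<rho>' where "\<rho>' = case_nat (d + 1) (case_nat (d + 2) \<rho>)"
  define body where "body = Seq (compile b \<rho>' (d + 3))
      (Seq (Const (d + 1) 0) (Seq (Add (d + 1) (d + 1) (d + 3)) (Seq (Const (d + 3) 1)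
      (Seq (Add (d + 2) (d + 2) (d + 3)) (Sub d d (d + 3))))))"
  have acc_Suc: "acc (Suc k) = eval b (env' k)" for k by (simp add: acc_def env'_def)
  \<comment> \<open>Loop invariant: register \<open>d\<close> holds the \<open>r\<close> rounds
    left, \<open>d + 1\<close> the accumulator and \<open>d + 2\<close> the \<open>k\<close> rounds
    done. Register \<open>d + 3\<close> serves first for the result of the body, then for the
    constant 1.\<close>
  have loop: "\<exists>s'. ram_exec dg (WhileNZ d body) s0 ((\<Sum>j\<in>{k..<k + r}. cost b (env' j) + 6) + 1) s' \<and>
      regs s' (d + 1) = acc (k + r) \<and> (\<forall>j<d. regs s' j = regs s j)"
    if "regs s0 d = r" "regs s0 (d + 1) = acc k" "regs s0 (d + 2) = k" "\<And>j. j < d \<Longrightarrow> regs s0 j = regs s j"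
    for s0 r k
    using that
  proof (induction r arbitrary: s0 k)
    case 0
    then show ?case using ram_exec.WhileFalse[of s0 d dg body] by auto
  next
    case (Suc r)
    have "\<exists>s'. ram_exec dg (compile b \<rho>' (d + 3)) s0 (cost b (env' k)) s' \<and>
      regs s' (d + 3) = eval b (env' k) \<and> (\<forall>j<d + 3. regs s' j = regs s0 j)"
      using Suc.prems Fold.prems
      by (intro Fold.IH(3)) (auto simp: \<rho>'_def env'_def less_SucI trans_less_add1 split: nat.split)
    then obtain s1 where 1: "ram_exec dg (compile b \<rho>' (d + 3)) s0 (cost b (env' k)) s1"
      "regs s1 (d + 3) = eval b (env' k)" "\<And>j. j < d + 3 \<Longrightarrow> regs s1 j = regs s0 j" by blast
    define s2 where "s2 = s1\<lparr>regs := (regs s1)(d + 1 := regs s1 (d + 3), d + 3 := 1,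
      d + 2 := regs s1 (d + 2) + 1, d := regs s1 d - 1)\<rparr>"
    have "ram_exec dg body s0 (cost b (env' k) + 5) s2"
      unfolding body_def
      by (rule ram_exec_SeqI[OF 1(1)], rule ram_exec_SeqI, rule ram_exec_ConstI[OF refl refl],
          rule ram_exec_SeqI, rule ram_exec_AddI[OF refl refl], rule ram_exec_SeqI,
          rule ram_exec_ConstI[OF refl refl], rule ram_exec_SeqI, rule ram_exec_AddI[OF refl refl],
          rule ram_exec_SubI[OF refl]) (auto simp: s2_def fun_eq_iff)
    moreover have "\<exists>s'. ram_exec dg (WhileNZ d body) s2 ((\<Sum>j\<in>{Suc k..<Suc k + r}. cost b (env' j) + 6) + 1) s' \<and>
      regs s' (d + 1) = acc (Suc k + r) \<and> (\<forall>j<d. regs s' j = regs s j)"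
      using Suc.prems 1 by (intro Suc.IH) (auto simp: s2_def acc_Suc)
    then obtain s3 where 3: "ram_exec dg (WhileNZ d body) s2
        ((\<Sum>j\<in>{Suc k..<Suc k + r}. cost b (env' j) + 6) + 1) s3"
      "regs s3 (d + 1) = acc (Suc k + r)" "\<forall>j<d. regs s3 j = regs s j" by blast
    have "(\<Sum>j\<in>{k..<k + Suc r}. cost b (env' j) + 6) =
      cost b (env' k) + 6 + (\<Sum>j\<in>{Suc k..<Suc k + r}. cost b (env' j) + 6)"
      by (subst sum.atLeast_Suc_lessThan) auto
    with ram_exec.WhileTrue[OF _ calculation 3(1)] Suc.prems(1) 3(2,3) show ?case
      by (intro exI[of _ s3]) (auto simp: add_ac)
  qed
  from Fold.IH(1)[OF Fold.prems] obtain s1 where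
    1: "ram_exec dg (compile n \<rho> d) s (cost n env) s1" "regs s1 d = eval n env"
       "\<And>j. j < d \<Longrightarrow> regs s1 j = regs s j" by blast
  have "\<exists>s'. ram_exec dg (compile a \<rho> (d + 1)) s1 (cost a env) s' \<and> regs s' (d + 1) = eval a env \<and>
    (\<forall>j<d + 1. regs s' j = regs s1 j)"
    using Fold.prems 1(3) by (intro Fold.IH(2)) (auto simp: less_SucI)
  then obtain s2 where 2: "ram_exec dg (compile a \<rho> (d + 1)) s1 (cost a env) s2"
    "regs s2 (d + 1) = eval a env" "\<And>j. j < d + 1 \<Longrightarrow> regs s2 j = regs s1 j" by blast
  let ?s3 = "s2\<lparr>regs := (regs s2)(d + 2 := 0)\<rparr>"
  have "\<exists>s'. ram_exec dg (WhileNZ d body) ?s3 ((\<Sum>j\<in>{0..<0 + eval n env}. cost b (env' j) + 6) + 1) s' \<and>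
      regs s' (d + 1) = acc (0 + eval n env) \<and> (\<forall>j<d. regs s' j = regs s j)"
    using 1 2 by (intro loop) (auto simp: acc_def)
  then obtain s4 where 4: "ram_exec dg (WhileNZ d body) ?s3 ((\<Sum>j<eval n env. cost b (env' j) + 6) + 1) s4"
    "regs s4 (d + 1) = acc (eval n env)" "\<forall>j<d. regs s4 j = regs s j"
    by (auto simp: atLeast0LessThan)
  let ?s5 = "s4\<lparr>regs := (regs s4)(d := regs s4 (d + 1))\<rparr>"
  have "ram_exec dg (compile (Fold n a b) \<rho> d) s (cost (Fold n a b) env) ?s5"
    unfolding compile.simps \<rho>'_def[symmetric] body_def[symmetric]
    by (rule ram_exec_SeqI[OF 1(1)], rule ram_exec_SeqI[OF 2(1)], rule ram_exec_SeqI,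
        rule ram_exec_ConstI[OF refl refl], rule ram_exec_SeqI[OF 4(1)], rule ram_exec_move)
      (simp_all add: env'_def acc_def)
  then show ?case using 4 by (intro exI[of _ ?s5]) (auto simp: acc_def)
qed

text \<open>Only iteration counts are restricted, not the size of values: with unit-cost
  instructions they alone determine the running time.\<close>

primrec loops_le :: "nat \<Rightarrow> expr \<Rightarrow> (nat \<Rightarrow> nat) \<Rightarrow> bool" where
  "loops_le B (Var i) env \<longleftrightarrow> True"
| "loops_le B (Lit n) env \<longleftrightarrow> True"
| "loops_le B (Plus a b) env \<longleftrightarrow> loops_le B a env \<and> loops_le B b env"
| "loops_le B (Monus a b) env \<longleftrightarrow> loops_le B a env \<and> loops_le B b env"
| "loops_le B (Bind a b) env \<longleftrightarrow> loops_le B a env \<and> loops_le B b (case_nat (eval a env) env)"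
| "loops_le B (Fold n a b) env \<longleftrightarrow> loops_le B n env \<and> loops_le B a env \<and> eval n env \<le> B \<and>
    (\<forall>k<eval n env. loops_le B b (case_nat (eval (Fold (Lit k) a b) env) (case_nat k env)))"

lemma add_powers_le:
  assumes "x \<ge> (2 :: nat)" shows "x ^ a + x ^ b + 2 \<le> x ^ (a + b + 2)"
proof -
  have "x ^ a \<le> x ^ (a + b)" "x ^ b \<le> x ^ (a + b)" "1 \<le> x ^ (a + b)"
    using assms by (auto intro: power_increasing)
  then have "x ^ a + x ^ b + 2 \<le> 2 * 2 * x ^ (a + b)" by linarith
  also have "\<dots> \<le> x * x * x ^ (a + b)" using assms by (intro mult_le_mono) auto
  finally show ?thesis by (simp add: power_add mult_ac power2_eq_square)
qed

lemma loop_powers_le: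
  assumes x: "x \<ge> (2 :: nat)" shows "x ^ a + x ^ b + x * (x ^ c + 6) + 4 \<le> x ^ (a + b + c + 5)"
proof -
  let ?m = "a + b + c"
  have le: "x ^ a \<le> x ^ ?m" "x ^ b \<le> x ^ ?m" "x ^ c \<le> x ^ ?m" "1 \<le> x ^ ?m"
    using x by (auto intro: power_increasing)
  then have "x ^ c + 6 \<le> 7 * x ^ ?m" by linarith
  then have "x * (x ^ c + 6) \<le> x * (7 * x ^ ?m)" by (rule mult_le_mono2)
  then have "x ^ a + x ^ b + x * (x ^ c + 6) + 4 \<le> 6 * x ^ ?m + x * (7 * x ^ ?m)"
    using le by linarith
  also have "\<dots> \<le> 16 * (x * x ^ ?m)"
  proof -
    have "x ^ ?m \<le> x * x ^ ?m" using x by simp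
    then show ?thesis unfolding mult.left_commute[of x 7] by linarith
  qed
  also have "\<dots> \<le> x ^ 4 * (x * x ^ ?m)"
    using power_mono[OF x, of 4] by (intro mult_le_mono) auto
  also have "\<dots> = x ^ (?m + 5)" by (simp add: power_add eval_nat_numeral mult_ac)
  finally show ?thesis .
qed

text \<open>\<open>C\<close> depends on the expression only, because the nesting of loops is fixed
  by the syntax. The base \<open>B + 2\<close> is at least 2, so constant overheads are absorbed by
  larger exponents.\<close>

lemma cost_le: "\<exists>C. \<forall>B env. loops_le B e env \<longrightarrow> cost e env \<le> (B + 2) ^ C"
proof (induction e)
  case (Var i)
  show ?case by (intro exI[of _ 1]) auto
next
  case (Lit n)
  show ?case by (intro exI[of _ 1]) auto
next
  case (Plus a b)
  then obtain C1 C2 where *: "\<And>B env. loops_le B a env \<Longrightarrow> cost a env \<le> (B + 2) ^ C1"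
    "\<And>B env. loops_le B b env \<Longrightarrow> cost b env \<le> (B + 2) ^ C2" by blast
  have "cost (Plus a b) env \<le> (B + 2) ^ (C1 + C2 + 2)" if "loops_le B (Plus a b) env" for B env
    using *(1)[of B env] *(2)[of B env] that add_powers_le[of "B + 2" C1 C2]
    unfolding cost.simps loops_le.simps by linarith
  then show ?case by blast
next
  case (Monus a b)
  then obtain C1 C2 where *: "\<And>B env. loops_le B a env \<Longrightarrow> cost a env \<le> (B + 2) ^ C1"
    "\<And>B env. loops_le B b env \<Longrightarrow> cost b env \<le> (B + 2) ^ C2" by blast
  have "cost (Monus a b) env \<le> (B + 2) ^ (C1 + C2 + 2)" if "loops_le B (Monus a b) env" for B env
    using *(1)[of B env] *(2)[of B env] that add_powers_le[of "B + 2" C1 C2]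
    unfolding cost.simps loops_le.simps by linarith
  then show ?case by blast
next
  case (Bind a b)
  then obtain C1 C2 where *: "\<And>B env. loops_le B a env \<Longrightarrow> cost a env \<le> (B + 2) ^ C1"
    "\<And>B env. loops_le B b env \<Longrightarrow> cost b env \<le> (B + 2) ^ C2" by blast
  have "cost (Bind a b) env \<le> (B + 2) ^ (C1 + C2 + 2)" if "loops_le B (Bind a b) env" for B env
    using *(1)[of B env] *(2)[of B "case_nat (eval a env) env"] that add_powers_le[of "B + 2" C1 C2]
    unfolding cost.simps loops_le.simps by linarith
  then show ?case by blast
next
  case (Fold n a b)
  then obtain C1 C2 C3 where *: "\<And>B env. loops_le B n env \<Longrightarrow> cost n env \<le> (B + 2) ^ C1"
    "\<And>B env. loops_le B a env \<Longrightarrow> cost a env \<le> (B + 2) ^ C2"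
    "\<And>B env. loops_le B b env \<Longrightarrow> cost b env \<le> (B + 2) ^ C3" by blast
  have "cost (Fold n a b) env \<le> (B + 2) ^ (C1 + C2 + C3 + 5)" if l: "loops_le B (Fold n a b) env" for B env
  proof -
    have "(\<Sum>k<eval n env. cost b (case_nat (eval (Fold (Lit k) a b) env) (case_nat k env)) + 6) \<le>
        (\<Sum>k<eval n env. (B + 2) ^ C3 + 6)"
      using l unfolding loops_le.simps by (intro sum_mono add_mono *(3) order_refl) simp
    also have "\<dots> = eval n env * ((B + 2) ^ C3 + 6)" by simp
    also have "\<dots> \<le> (B + 2) * ((B + 2) ^ C3 + 6)"
      using l unfolding loops_le.simps by (intro mult_le_mono) auto
    finally show ?thesis
      using *(1)[of B env] *(2)[of B env] l loop_powers_le[of "B + 2" C1 C2 C3]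
      unfolding cost.simps loops_le.simps by linarith
  qed
  then show ?case by blast
qed

subsection \<open>Exhaustive search\<close>

lemma rec_nat_sum: "rec_nat (0 :: nat) (\<lambda>k v. v + g k) n = (\<Sum>k<n. g k)"
  by (induction n) auto

lemma rec_nat_double: "rec_nat (a :: nat) (\<lambda>k v. v + v) n = a * 2 ^ n"
  by (induction n) auto

text \<open>The machine has no division, so the parity is obtained by toggling between 0 and
  1.\<close>

definition parity_expr :: "nat \<Rightarrow> expr" where
  "parity_expr i = Fold (Var i) (Lit 0) (Monus (Lit 1) (Var 0))"

lemma eval_parity_expr [simp]: "eval (parity_expr i) env = env i mod 2"
proof -
  have "rec_nat 0 (\<lambda>k v. 1 - v) n = n mod 2" for n :: nat
    by (induction n) (auto simp: mod_Suc)
  then show ?thesis by (simp add: parity_expr_def)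
qed

lemma loops_le_parity_expr [simp]: "loops_le B (parity_expr i) env \<longleftrightarrow> env i \<le> B"
  by (simp add: parity_expr_def)

text \<open>\<open>n div 2\<close> is the number of odd \<open>k < n\<close>; variable 1 is the loop
  index.\<close>

definition half_expr :: "nat \<Rightarrow> expr" where
  "half_expr i = Fold (Var i) (Lit 0) (Plus (Var 0) (parity_expr 1))"

lemma eval_half_expr [simp]: "eval (half_expr i) env = env i div 2"
proof -
  have "(\<Sum>k<n. k mod 2) = n div 2" for n :: nat
  proof (induction n)
    case (Suc n)
    then have "(\<Sum>k<Suc n. k mod 2) = n div 2 + n mod 2" by simp
    then show ?case by presburger
  qed simp
  then show ?thesis by (simp add: half_expr_def rec_nat_sum)
qed

lemma loops_le_half_expr [simp]: "loops_le B (half_expr i) env \<longleftrightarrow> env i \<le> B"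
  by (auto simp: half_expr_def)

definition shift_expr :: "nat \<Rightarrow> expr \<Rightarrow> expr" where
  "shift_expr i e = Fold e (Var i) (half_expr 0)"

lemma rec_nat_half: "rec_nat (w :: nat) (\<lambda>k v. v div 2) n = w div 2 ^ n"
  by (induction n) (simp_all add: power_Suc2 div_mult2_eq del: power_Suc)

lemma eval_shift_expr [simp]: "eval (shift_expr i e) env = env i div 2 ^ eval e env"
  by (simp add: shift_expr_def rec_nat_half)

lemma loops_le_shift_expr:
  "loops_le B e env \<Longrightarrow> eval e env \<le> B \<Longrightarrow> env i \<le> B \<Longrightarrow> loops_le B (shift_expr i e) env"
  by (auto simp: shift_expr_def rec_nat_half intro: order_trans[OF div_le_dividend])

definition bit_expr :: "nat \<Rightarrow> expr \<Rightarrow> expr" where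
  "bit_expr i e = Bind (shift_expr i e) (parity_expr 0)"

lemma eval_bit_expr [simp]:
  "eval (bit_expr i e) env = of_bool (eval e env \<in> set_decode (env i))"
  by (simp add: bit_expr_def set_decode_def odd_iff_mod_2_eq_one)

lemma loops_le_bit_expr:
  "loops_le B e env \<Longrightarrow> eval e env \<le> B \<Longrightarrow> env i \<le> B \<Longrightarrow> loops_le B (bit_expr i e) env"
  by (auto simp: bit_expr_def loops_le_shift_expr intro: order_trans[OF div_le_dividend])

definition mult_expr :: "nat \<Rightarrow> nat \<Rightarrow> expr" where
  "mult_expr i j = Fold (Var i) (Lit 0) (Plus (Var 0) (Var (Suc (Suc j))))"

lemma eval_mult_expr [simp]: "eval (mult_expr i j) env = env i * env j"
  by (simp add: mult_expr_def rec_nat_sum)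

lemma loops_le_mult_expr [simp]: "loops_le B (mult_expr i j) env \<longleftrightarrow> env i \<le> B"
  by (simp add: mult_expr_def)

definition pow2_expr :: "expr \<Rightarrow> expr" where
  "pow2_expr e = Fold e (Lit 1) (Plus (Var 0) (Var 0))"

lemma eval_pow2_expr [simp]: "eval (pow2_expr e) env = 2 ^ eval e env"
  by (simp add: pow2_expr_def rec_nat_double)

lemma loops_le_pow2_expr [simp]:
  "loops_le B (pow2_expr e) env \<longleftrightarrow> loops_le B e env \<and> eval e env \<le> B"
  by (auto simp: pow2_expr_def)

definition sum_expr :: "expr \<Rightarrow> expr \<Rightarrow> expr" where
  "sum_expr n b = Fold n (Lit 0) (Plus (Var 0) b)"

text \<open>Every enclosing loop shifts the variables of its context by two. In \<open>search_expr\<close> the index of the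
  outer loop encodes a subset of \<open>{..N}\<close>, with \<open>N\<close> in variable 0.
  Seen from \<open>gp3_expr\<close>, variable 7 is that code and variables 5, 3, 1 are the three candidate terms.\<close>

definition gp3_expr :: expr where
  "gp3_expr = Monus (Lit 1) (Plus (Plus (Plus (Monus (Lit 1) (bit_expr 7 (Var 5)))
      (Monus (Lit 1) (bit_expr 7 (Var 3)))) (Monus (Lit 1) (bit_expr 7 (Var 1))))
    (Plus (Monus (Plus (Var 5) (Lit 1)) (Var 3))
      (Plus (Monus (mult_expr 3 3) (mult_expr 5 1)) (Monus (mult_expr 5 1) (mult_expr 3 3)))))"

definition count_gp3_expr :: expr where
  "count_gp3_expr = (let n = \<lambda>i. Plus (Var i) (Lit 1) in
    sum_expr (n 2) (sum_expr (n 4) (sum_expr (n 6) gp3_expr)))"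

definition card_expr :: expr where
  "card_expr = sum_expr (Var 4) (bit_expr 5 (Plus (Var 1) (Lit 1)))"

text \<open>The loop acts as a conditional: it runs once if no progression was found and otherwise
  not at all. Inside it the code is variable 3 and \<open>N\<close> is variable 4.\<close>

definition value_expr :: expr where
  "value_expr = Fold (Monus (Lit 1) count_gp3_expr) (Lit 0) card_expr"

definition search_expr :: expr where
  "search_expr = Fold (pow2_expr (Plus (Var 0) (Lit 1))) (Lit 0)
    (Bind value_expr (Plus (Var 1) (Monus (Var 0) (Var 1))))"

definition bound_expr :: expr where
  "bound_expr = pow2_expr (Fold (Var 0) (Lit 152) (Plus (Var 0) (Var 0)))"

lemma eval_bound_expr: "eval bound_expr env = 2 ^ (152 * 2 ^ env 0)"
  by (simp add: bound_expr_def rec_nat_double)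

text \<open>A sum of defects is subtracted from 1: one for each of the three memberships,
  \<open>(x + 1) - y\<close> for \<open>x < y\<close>, and both truncated differences for
  \<open>y * y = x * z\<close>.\<close>

lemma eval_gp3_expr:
  "eval gp3_expr env = of_bool (env 5 \<in> set_decode (env 7) \<and> env 3 \<in> set_decode (env 7) \<and>
    env 1 \<in> set_decode (env 7) \<and> env 5 < env 3 \<and> env 3 * env 3 = env 5 * env 1)"
  by (auto simp: gp3_expr_def)

lemma eval_count_gp3_expr:
  "eval count_gp3_expr env = 0 \<longleftrightarrow> gp3_free (set_decode (env 1) \<inter> {..env 2})"
proof -
  obtain n where n: "Suc (env 2) = n" by blast
  then have le: "x \<le> env 2 \<longleftrightarrow> x < n" for x by auto
  show ?thesis
    by (auto simp: count_gp3_expr_def sum_expr_def rec_nat_sum eval_gp3_expr gp3_free_iff Let_def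
        n le simp del: sum_of_bool_eq)
qed

lemma eval_card_expr:
  "eval card_expr env = card (set_decode (env 3) \<inter> {1..env 4})"
proof -
  have "(\<Sum>k<n. of_bool (Suc k \<in> X)) = card (X \<inter> {1..n})" for X n
  proof (induction n)
    case (Suc n)
    have "X \<inter> {1..Suc n} = (if Suc n \<in> X then insert (Suc n) (X \<inter> {1..n}) else X \<inter> {1..n})"
      by (auto simp: le_Suc_eq)
    then show ?case using Suc by simp
  qed simp
  then show ?thesis
    by (simp add: card_expr_def sum_expr_def rec_nat_sum del: set_decode_Suc sum_of_bool_eq)
qed

lemma eval_value_expr:
  "eval value_expr env = (if gp3_free (set_decode (env 1) \<inter> {..env 2})
    then card (set_decode (env 1) \<inter> {1..env 2}) else 0)"
proof (cases "eval count_gp3_expr env = 0")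
  case True
  then show ?thesis using eval_count_gp3_expr[of env] by (simp add: value_expr_def eval_card_expr)
next
  case False
  then show ?thesis using eval_count_gp3_expr[of env] by (simp add: value_expr_def)
qed

text \<open>With truncated subtraction, \<open>v + (g k - v)\<close> is the maximum of
  \<open>v\<close> and \<open>g k\<close>.\<close>

lemma rec_nat_max: 
  "rec_nat 0 (\<lambda>k v. v + (g k - v)) n = Max (insert 0 (g ` {..<n}))" for g :: "nat \<Rightarrow> nat"
proof (induction n)
  case (Suc n)
  have "Max (insert 0 (g ` {..<Suc n})) = max (g n) (Max (insert 0 (g ` {..<n})))"
    by (simp add: lessThan_Suc insert_commute[of 0])
  then show ?case using Suc by simp
qed simp

text \<open>Codes below \<open>2 ^ Suc N\<close> run through the subsets of \<open>{..N}\<close>. A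
  coded set may contain 0, but only its elements in \<open>{1..N}\<close> are counted, so no value
  exceeds the optimum; the code of an optimal set attains it.\<close>

lemma eval_search_expr: "eval search_expr env = gp3_max {1..env 0}"
proof -
  let ?N = "env 0"
  define g where "g w = (if gp3_free (set_decode w \<inter> {..?N}) then card (set_decode w \<inter> {1..?N}) else 0)" for w
  have "eval search_expr env = Max (insert 0 (g ` {..<2 ^ Suc ?N}))"
    by (simp add: search_expr_def eval_value_expr rec_nat_max g_def cong: if_cong)
  also have "\<dots> = gp3_max {1..?N}"
  proof (rule Max_eqI)
    fix v assume "v \<in> insert 0 (g ` {..<2 ^ Suc ?N})"
    moreover have "g w \<le> gp3_max {1..?N}" for w
    proof -
      have "set_decode w \<inter> {1..?N} \<subseteq> set_decode w \<inter> {..?N}" by auto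
      then show ?thesis
        using gp3_free_subset by (simp add: g_def card_le_gp3_max del: One_nat_def)
    qed
    ultimately show "v \<le> gp3_max {1..?N}" by auto
  next
    obtain A where A: "A \<subseteq> {1..?N}" "gp3_free A" "card A = gp3_max {1..?N}"
      using gp3_max_attained[of "{1..?N}"] by auto
    have fin: "finite A" using A(1) finite_subset by blast
    have "set_encode A \<le> set_encode {..<Suc ?N}"
      unfolding set_encode_def using A(1) by (intro sum_mono2) auto
    also have "\<dots> < 2 ^ Suc ?N"
      unfolding set_encode_def using sum_power2[of "Suc ?N"] by (simp add: atLeast0LessThan)
    finally have "set_encode A \<in> {..<2 ^ Suc ?N}" by simp
    moreover have "A \<inter> {..?N} = A" "A \<inter> {1..?N} = A" using A(1) by auto
    then have "g (set_encode A) = gp3_max {1..?N}" using A(2,3) fin by (simp add: g_def)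
    ultimately show "gp3_max {1..?N} \<in> insert 0 (g ` {..<2 ^ Suc ?N})" by (metis imageI insertI2)
  qed auto
  finally show ?thesis .
qed

lemma loops_le_bound_expr:
  assumes "152 * 2 ^ env 0 \<le> B" shows "loops_le B bound_expr env"
proof -
  have "env 0 \<le> 2 ^ env 0" using less_exp less_imp_le by blast
  then have "env 0 \<le> B" using assms by linarith
  then show ?thesis using assms by (simp add: bound_expr_def rec_nat_double)
qed

text \<open>The longest loops are the search itself and the halving of a code, which takes as many
  rounds as the value of the code; codes stay below \<open>2 ^ Suc (env 0)\<close>.\<close>

lemma loops_le_search_expr: "loops_le (2 ^ Suc (env 0)) search_expr env"
proof -
  let ?B = "2 ^ Suc (env 0) :: nat"
  have N: "Suc (env 0) \<le> ?B" using less_exp[of "Suc (env 0)"] by (rule less_imp_le)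
  have le: "k \<le> ?B" if "k < Suc (env 0)" for k using that N by linarith
  have one: "Suc 0 - k \<le> ?B" for k using N by linarith
  have gp3: "loops_le ?B gp3_expr e" if "e 1 \<le> ?B" "e 3 \<le> ?B" "e 5 \<le> ?B" "e 7 \<le> ?B" for e
    using that by (simp add: gp3_expr_def loops_le_bit_expr del: power_Suc)
  have "loops_le ?B count_gp3_expr e" if "e 1 \<le> ?B" "e 2 = env 0" for e
    using that N by (auto simp: count_gp3_expr_def sum_expr_def Let_def le simp del: power_Suc intro!: gp3)
  moreover have "loops_le ?B card_expr e" if "e 3 \<le> ?B" "e 4 = env 0" for e
    using that Suc_leD[OF N] le[OF Suc_mono]
    by (auto simp: card_expr_def sum_expr_def simp del: power_Suc intro!: loops_le_bit_expr)
  ultimately have "loops_le ?B value_expr e" if "e 1 \<le> ?B" "e 2 = env 0" for e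
    using that one by (auto simp: value_expr_def simp del: power_Suc)
  then show ?thesis using N by (auto simp: search_expr_def simp del: power_Suc)
qed

section \<open>Reading off the precision and assembling the program\<close>

definition first_digit_prog :: ram_prog where
  "first_digit_prog = Seq (Const 1 1) (Seq (Input 2 0) (Seq (Sub 1 1 2)
    (WhileNZ 1 (Seq (Const 1 1) (Seq (Add 0 0 1) (Seq (Const 1 1) (Seq (Input 2 0) (Sub 1 1 2))))))))"

text \<open>Register 1 holds one minus the current digit, so the loop ends at the first digit 1.
  Each of the \<open>i\<close> rounds takes a test and five instructions; three initial instructions
  and the last test give the 4.\<close>

lemma first_digit_prog_correct:
  assumes i: "dg i" "\<And>j. j < i \<Longrightarrow> \<not> dg j"
  shows "\<exists>s'. ram_exec dg first_digit_prog ram_init (6 * i + 4) s' \<and> regs s' 0 = i"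
proof -
  define body where "body = Seq (Const 1 1) (Seq (Add 0 0 1) (Seq (Const 1 1) (Seq (Input 2 0) (Sub 1 1 2))))"
  have loop: "\<exists>s'. ram_exec dg (WhileNZ 1 body) s (6 * r + 1) s' \<and> regs s' 0 = i"
    if "regs s 0 + r = i" "regs s 1 = 1 - of_bool (dg (regs s 0))" for s r
    using that
  proof (induction r arbitrary: s)
    case 0
    then show ?case using i ram_exec.WhileFalse[of s 1 dg body] by auto
  next
    case (Suc r)
    then have nz: "regs s 1 \<noteq> 0" using i(2)[of "regs s 0"] by simp
    define s1 where "s1 = s\<lparr>regs := (regs s)(0 := Suc (regs s 0), 2 := of_bool (dg (Suc (regs s 0))),
      1 := 1 - of_bool (dg (Suc (regs s 0))))\<rparr>"
    have "ram_exec dg body s 5 s1"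
      unfolding body_def
      by (rule ram_exec_SeqI, rule ram_exec_ConstI[OF refl refl], rule ram_exec_SeqI,
          rule ram_exec_AddI[OF refl refl], rule ram_exec_SeqI, rule ram_exec_ConstI[OF refl refl],
          rule ram_exec_SeqI, rule ram_exec_InputI[OF refl refl], rule ram_exec_SubI[OF refl])
        (auto simp: s1_def fun_eq_iff)
    moreover have "\<exists>s'. ram_exec dg (WhileNZ 1 body) s1 (6 * r + 1) s' \<and> regs s' 0 = i"
      using Suc.prems by (intro Suc.IH) (auto simp: s1_def)
    then obtain s2 where "ram_exec dg (WhileNZ 1 body) s1 (6 * r + 1) s2" "regs s2 0 = i" by blast
    ultimately show ?case
      using ram_exec.WhileTrue[OF nz, of dg body 5 s1 "6 * r + 1" s2] by (intro exI[of _ s2]) auto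
  qed
  define s0 where "s0 = ram_init\<lparr>regs := (\<lambda>_. 0)(1 := 1 - of_bool (dg 0), 2 := of_bool (dg 0))\<rparr>"
  have "\<exists>s'. ram_exec dg (WhileNZ 1 body) s0 (6 * i + 1) s' \<and> regs s' 0 = i"
    by (rule loop) (auto simp: s0_def)
  then obtain s' where s': "ram_exec dg (WhileNZ 1 body) s0 (6 * i + 1) s'" "regs s' 0 = i" by blast
  have "ram_exec dg first_digit_prog ram_init (6 * i + 4) s'"
    unfolding first_digit_prog_def body_def[symmetric]
    by (rule ram_exec_SeqI, rule ram_exec_ConstI[OF refl refl], rule ram_exec_SeqI,
        rule ram_exec_InputI[OF refl refl], rule ram_exec_SeqI, rule ram_exec_SubI[OF refl refl])
      (use s'(1) in \<open>auto simp: s0_def ram_init_def fun_upd_twist\<close>)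
  then show ?thesis using s'(2) by blast
qed

text \<open>Register 0 receives \<open>i\<close>, register 1 \<open>N\<close>, register 2 the
  optimum. The search leaves register 1 intact, so after the final move the output quotient has
  denominator \<open>N\<close>.\<close>

definition alpha_prog :: ram_prog where
  "alpha_prog = Seq first_digit_prog (Seq (compile bound_expr (\<lambda>_. 0) 1)
    (Seq (compile search_expr (\<lambda>_. 1) 2) (Seq (Const 0 0) (Add 0 0 2))))"

lemma alpha_prog_computes:
  assumes i: "dg i" "\<And>j. j < i \<Longrightarrow> \<not> dg j" and N: "N = 2 ^ (152 * 2 ^ i)"
  shows "ram_computes alpha_prog dg
    (6 * i + 6 + cost bound_expr (\<lambda>_. i) + cost search_expr (\<lambda>_. N)) (max_density N)"
proof -
  obtain s1 where 1: "ram_exec dg first_digit_prog ram_init (6 * i + 4) s1" "regs s1 0 = i"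
    using first_digit_prog_correct[of dg i] i by blast
  obtain s2 where 2: "ram_exec dg (compile bound_expr (\<lambda>_. 0) 1) s1 (cost bound_expr (\<lambda>_. i)) s2"
    "regs s2 1 = N"
    using compile_correct[of "\<lambda>_. 0" 1 s1 "\<lambda>_. i" dg bound_expr] 1 by (auto simp: eval_bound_expr N)
  obtain s3 where 3: "ram_exec dg (compile search_expr (\<lambda>_. 1) 2) s2 (cost search_expr (\<lambda>_. N)) s3"
    "regs s3 2 = gp3_max {1..N}" "regs s3 1 = N"
    using compile_correct[of "\<lambda>_. 1" 2 s2 "\<lambda>_. N" dg search_expr] 2 by (auto simp: eval_search_expr)
  let ?s4 = "s3\<lparr>regs := (regs s3)(0 := regs s3 2)\<rparr>"
  have "ram_exec dg alpha_prog ram_init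
      (6 * i + 6 + cost bound_expr (\<lambda>_. i) + cost search_expr (\<lambda>_. N)) ?s4"
    unfolding alpha_prog_def
    by (rule ram_exec_SeqI[OF 1(1)], rule ram_exec_SeqI[OF 2(1)], rule ram_exec_SeqI[OF 3(1)],
        rule ram_exec_move) auto
  then show ?thesis
    unfolding ram_computes_def using 3 by (intro exI[of _ ?s4]) (auto simp: max_density_def N)
qed

text \<open>All loop counts are at most \<open>2 ^ Suc N\<close>, and by \<open>cost_le\<close> the
  time is polynomial in this bound, hence singly exponential in \<open>N\<close>.\<close>

lemma alpha_prog_time:
  obtains C where "\<And>i N. N = 2 ^ (152 * 2 ^ i) \<Longrightarrow>
    6 * i + 6 + cost bound_expr (\<lambda>_. i) + cost search_expr (\<lambda>_. N) \<le> 2 ^ (C * (N + 2))"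
proof -
  obtain C1 where C1: "\<And>B env. loops_le B bound_expr env \<Longrightarrow> cost bound_expr env \<le> (B + 2) ^ C1"
    using cost_le[of bound_expr] by blast
  obtain C2 where C2: "\<And>B env. loops_le B search_expr env \<Longrightarrow> cost search_expr env \<le> (B + 2) ^ C2"
    using cost_le[of search_expr] by blast
  have "6 * i + 6 + cost bound_expr (\<lambda>_. i) + cost search_expr (\<lambda>_. N) \<le> 2 ^ ((C1 + C2 + 5) * (N + 2))"
    if N: "N = 2 ^ (152 * 2 ^ i)" for i N
  proof -
    define B :: nat where "B = 2 ^ Suc N"
    have less: "n < 2 ^ n" for n :: nat by (rule less_exp)
    have "152 * 2 ^ i < N" unfolding N by (rule less)
    moreover have "Suc N < B" unfolding B_def by (rule less)
    ultimately have M: "152 * 2 ^ i \<le> B" by linarith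
    have "i \<le> B" using less[of i] M by linarith
    \<comment> \<open>The bound is written in the shape that \<open>loop_powers_le\<close> absorbs,
      with \<open>c = 0\<close>.\<close>
    then have "6 * i + 6 \<le> (B + 2) * ((B + 2) ^ 0 + 6) + 4" by simp
    moreover have "cost bound_expr (\<lambda>_. i) \<le> (B + 2) ^ C1"
      using M by (intro C1 loops_le_bound_expr) simp
    moreover have "cost search_expr (\<lambda>_. N) \<le> (B + 2) ^ C2"
      using loops_le_search_expr[of "\<lambda>_. N"] by (intro C2) (simp add: B_def)
    ultimately have "6 * i + 6 + cost bound_expr (\<lambda>_. i) + cost search_expr (\<lambda>_. N) \<le>
        (B + 2) ^ (C1 + C2 + 0 + 5)"
      using loop_powers_le[of "B + 2" C1 C2 0] by linarith
    also have "\<dots> \<le> (2 ^ (N + 2)) ^ (C1 + C2 + 0 + 5)"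
    proof (rule power_mono)
      show "B + 2 \<le> 2 ^ (N + 2)" using one_le_power[of "2 :: nat" N] by (simp add: B_def)
    qed simp
    also have "\<dots> = 2 ^ ((C1 + C2 + 5) * (N + 2))" by (simp only: power_mult[symmetric] mult.commute add_0_right)
    finally show ?thesis .
  qed
  then show thesis using that by blast
qed

text \<open>Small \<open>1 / \<epsilon>\<close> are absorbed by the constant; beyond \<open>x0\<close> the base \<open>- 2 * log 2 \<epsilon>\<close> exceeds
  \<open>2 powr (152 + m)\<close>.\<close>

lemma time_bound_bigo:
  fixes C :: real
  assumes C: "C \<ge> 0"
  shows "(\<lambda>\<epsilon>. 2 powr (C * (2 powr (152 / \<epsilon>) + 2)))
    \<in> O[principal {0<..<1}](\<lambda>\<epsilon>. 1.6538 powr ((- 2 * log 2 \<epsilon>) powr (1 / \<epsilon>)))"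
proof -
  \<comment> \<open>The factor 6 is \<open>3 * 2\<close>: 3 comes from
    \<open>z + 2 \<le> 3 * z\<close>, and 2 leaves the exponent \<open>y / 2\<close>, enough because
    \<open>sqrt 2 \<le> 1.6538\<close>.\<close>
  obtain m :: nat where m: "6 * C < 2 ^ m" using real_arch_pow[of 2 "6 * C"] by auto
  define a :: real where "a = 152 + m"
  define x0 :: real where "x0 = 2 powr (2 powr a)"
  define c where "c = 2 powr (C * (2 powr (152 * x0) + 2))"
  have "2 powr (C * (2 powr (152 / \<epsilon>) + 2)) \<le> c * 1.6538 powr ((- 2 * log 2 \<epsilon>) powr (1 / \<epsilon>))"
    if e: "0 < \<epsilon>" "\<epsilon> < 1" for \<epsilon> :: real
  proof -
    define x where "x = 1 / \<epsilon>"
    have x: "x > 1" using e by (simp add: x_def)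
    have e_x: "\<epsilon> = 1 / x" using e by (simp add: x_def)
    define y where "y = (2 * log 2 x) powr x"
    have y: "(- 2 * log 2 \<epsilon>) powr (1 / \<epsilon>) = y"
      using x by (simp add: y_def e_x log_divide)
    have c1: "1 \<le> c" unfolding c_def using C by (intro ge_one_powr_ge_zero) auto
    have g1: "1 \<le> (1.6538 :: real) powr y"
      by (intro ge_one_powr_ge_zero) (auto simp: y_def)
    have "2 powr (C * (2 powr (152 * x) + 2)) \<le> c * 1.6538 powr y"
    proof (cases "x \<le> x0")
      case True
      then have "2 powr (C * (2 powr (152 * x) + 2)) \<le> c"
        unfolding c_def using C by (intro powr_mono mult_left_mono add_right_mono) auto
      also have "\<dots> \<le> c * 1.6538 powr y" using c1 g1 by simp
      finally show ?thesis .
    next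
      case False
      define z where "z = 2 powr (152 * x)"
      have z: "1 \<le> z" unfolding z_def using x by (intro ge_one_powr_ge_zero) auto
      have "2 powr a \<le> log 2 x"
        using False x by (simp add: le_log_iff x0_def)
      moreover have "0 \<le> log 2 x" using x by simp
      ultimately have "2 powr a \<le> 2 * log 2 x" by linarith
      then have "(2 powr a) powr x \<le> y"
        unfolding y_def using x by (intro powr_mono2) auto
      moreover have "(2 powr a) powr x = z * 2 powr (m * x)"
        unfolding z_def powr_powr powr_add[symmetric] by (simp add: a_def distrib_right)
      moreover have "6 * C \<le> 2 powr (m * x)"
      proof -
        have "(2 :: real) ^ m \<le> 2 powr (m * x)"
          using x mult_left_mono[of 1 x m] by (subst powr_realpow[symmetric]) (auto intro!: powr_mono)
        then show ?thesis using m by linarith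
      qed
      ultimately have "z * (6 * C) \<le> y"
        using mult_left_mono[of "6 * C" "2 powr (m * x)" z] z by linarith
      moreover have "C * (z + 2) \<le> C * (3 * z)" using C z by (intro mult_left_mono) auto
      ultimately have "C * (z + 2) \<le> (1 / 2) * y" by (simp add: algebra_simps)
      then have "2 powr (C * (z + 2)) \<le> 2 powr ((1 / 2) * y)" by (intro powr_mono) auto
      also have "\<dots> = (2 powr (1 / 2)) powr y" by (simp add: powr_powr)
      also have "\<dots> \<le> 1.6538 powr y"
      proof (rule powr_mono2)
        have "2 powr (1 / 2) = sqrt (2 :: real)" by (simp add: powr_half_sqrt)
        also have "\<dots> \<le> 1.6538" by (intro real_le_lsqrt) (auto simp: power2_eq_square)
        finally show "2 powr (1 / 2) \<le> (1.6538 :: real)" .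
      qed (auto simp: y_def)
      also have "\<dots> \<le> c * 1.6538 powr y" using c1 g1 by simp
      finally show ?thesis by (simp add: z_def)
    qed
    then show ?thesis unfolding y by (simp add: x_def)
  qed
  then show ?thesis
    by (intro bigoI[of _ c]) (simp add: eventually_principal)
qed

text \<open>Digit \<open>i\<close> alone gives the lower bound, and a geometric series bounds the
  tail from above. The upper bound is not strict, since a tail consisting of ones is a legitimate
  presentation.\<close>

lemma binary_expansion_first_digit:
  assumes "binary_expansion d x" "0 < x"
  obtains i where "d i" "\<And>j. j < i \<Longrightarrow> \<not> d j" "1 / 2 ^ Suc i \<le> x" "x \<le> 1 / 2 ^ i"
proof -
  let ?f = "\<lambda>i. of_bool (d i) / 2 ^ Suc i :: real"
  have sums: "?f sums x" using assms by (simp add: binary_expansion_def)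
  have "\<exists>i. d i"
  proof (rule ccontr)
    assume "\<nexists>i. d i"
    then have "?f = (\<lambda>_. 0)" by auto
    then show False using sums assms(2) sums_unique2[OF sums_zero] by auto
  qed
  then obtain i where i: "d i" "\<And>j. j < i \<Longrightarrow> \<not> d j"
    using LeastI_ex[of d] not_less_Least by metis
  have "?f i \<le> x"
    using sum_le_suminf[of ?f "{i}"] sums by (auto simp: sums_iff)
  moreover have "x \<le> 1 / 2 ^ i"
  proof -
    have tail: "(\<lambda>n. ?f (n + i)) sums x"
      using sums_split_initial_segment[OF sums, of i] i(2) by simp
    have geo: "(\<lambda>n. (1 / 2 ^ i) * (1 / 2) ^ Suc n) sums (1 / 2 ^ i * (1 :: real))"
      by (intro sums_mult power_half_series)
    show ?thesis
      using sums_le[OF _ tail geo] by (simp add: power_add field_simps)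
  qed
  ultimately show thesis using that[OF i] i(1) by simp
qed

theorem theorem5p2:
  "\<exists>(c :: ram_prog) (T :: real \<Rightarrow> real).
     T \<in> O[principal {0<..<1}](\<lambda>\<epsilon>. 1.6538 powr ((- 2 * log 2 \<epsilon>) powr (1 / \<epsilon>))) \<and>
     (\<forall>(\<epsilon> :: real) (d :: nat \<Rightarrow> bool). 0 < \<epsilon> \<and> \<epsilon> < 1 \<and> binary_expansion d \<epsilon> \<longrightarrow>
        (\<exists>(t :: nat) (v :: real). ram_computes c d t v \<and> real t \<le> T \<epsilon> \<and>
           \<bar>v - alpha_bar\<bar> < \<epsilon>))"
proof -
  obtain C where C: "\<And>i N. N = 2 ^ (152 * 2 ^ i) \<Longrightarrow>
    6 * i + 6 + cost bound_expr (\<lambda>_. i) + cost search_expr (\<lambda>_. N) \<le> 2 ^ (C * (N + 2))"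
    using alpha_prog_time by blast
  \<comment> \<open>This is the bound of \<open>alpha_prog_time\<close> with \<open>N\<close>
    replaced by its upper estimate \<open>2 powr (152 / \<epsilon>)\<close>.\<close>
  let ?T = "\<lambda>\<epsilon>. 2 powr (real C * (2 powr (152 / \<epsilon>) + 2))"
  have "\<exists>t v. ram_computes alpha_prog d t v \<and> real t \<le> ?T \<epsilon> \<and> \<bar>v - alpha_bar\<bar> < \<epsilon>"
    if e: "0 < \<epsilon>" "\<epsilon> < 1" "binary_expansion d \<epsilon>" for \<epsilon> d
  proof -
    \<comment> \<open>The lower bound on \<open>\<epsilon>\<close> will guarantee the accuracy, the
      upper bound the running time.\<close>
    obtain i where i: "d i" "\<And>j. j < i \<Longrightarrow> \<not> d j" and lo: "1 / 2 ^ Suc i \<le> \<epsilon>" and hi: "\<epsilon> \<le> 1 / 2 ^ i"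
      using binary_expansion_first_digit[OF e(3,1)] by blast
    define N :: nat where "N = 2 ^ (152 * 2 ^ i)"
    let ?t = "6 * i + 6 + cost bound_expr (\<lambda>_. i) + cost search_expr (\<lambda>_. N)"
    have "real N = 2 powr (152 * 2 ^ i)"
      by (simp add: N_def powr_realpow[symmetric])
    also have "\<dots> \<le> 2 powr (152 / \<epsilon>)"
      using hi e(1) by (intro powr_mono) (auto simp: field_simps)
    finally have N: "real N \<le> 2 powr (152 / \<epsilon>)" .
    have "real ?t \<le> real (2 ^ (C * (N + 2)))"
      using C[OF N_def] by (simp only: of_nat_le_iff)
    also have "\<dots> = 2 powr (real C * (real N + 2))"
      by (simp add: powr_realpow[symmetric] algebra_simps)
    also have "\<dots> \<le> ?T \<epsilon>" using N by (intro powr_mono mult_left_mono add_right_mono) auto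
    finally have "real ?t \<le> ?T \<epsilon>" .
    moreover have "\<bar>max_density N - alpha_bar\<bar> < \<epsilon>"
      using max_density_exp_approx[of i] lo by (simp add: N_def)
    ultimately show ?thesis using alpha_prog_computes[of d i N] i N_def by blast
  qed
  with time_bound_bigo[of "real C"] show ?thesis
    by (intro exI[of _ alpha_prog] exI[of _ ?T]) auto
qed

end
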